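(* Under the standing assumption below, the set of metastable states is $\mathcal X^m=\{\underline{-1}\}$ and the maximal stability level is $\Gamma_m=\Gamma^{Hex}$.
   Context: Let $\mathbb{T}^2$ denote the triangular lattice embedded in $\mathbb{R}^2$ and $\mathbb{H}^2$ its dual, the hexagonal lattice; each vertex $i$ of $\mathbb{H}^2$ is the centre of a unique closed triangular face of $\mathbb{T}^2$ (the face centred at $i$), and $d$ denotes the graph distance on $\mathbb{H}^2$, so $d(i,j)=1$ iff the faces centred at $i$ and $j$ share an edge. Fix an integer $L\ge1$ and let $\Lambda\subset\mathbb{H}^2$ be the set of sites in a parallelogram of side length $L$ cut along two coordinate axes of $\mathbb{T}^2$, with periodic boundary conditions; thus $\Lambda$ is a discrete torus with $|\Lambda|=2L^2$ sites, each having 3 nearest neighbours. Let $\mathcal X=\{-1,+1\}^\Lambda$ and let $\underline{+1}$, $\underline{-1}$ be the configurations with all spins $+1$, resp. $-1$. For $J,h>0$ the Hamiltonian is $H(\sigma)=-\frac J2\sum_{\{i,j\}\subset\Lambda:\,d(i,j)=1}\sigma(i)\sigma(j)-\frac h2\sum_{i\in\Lambda}\sigma(i)$ (sum over unordered nearest-neighbour pairs), so that $H(\sigma)-H(\underline{-1})=J|\gamma(\sigma)|-hN^+(\sigma)$, where $|\gamma(\sigma)|$ is the number of nearest-neighbour pairs carrying opposite spins and $N^+(\sigma)$ is the number of sites with spin $+1$. For $x\in\Lambda$, $\sigma^{(x)}$ denotes $\sigma$ with the spin at $x$ reversed. For $\beta>0$, $(X_t)_{t\in\mathbb N}$ is the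 Metropolis chain on $\mathcal X$ with $P(\sigma,\sigma^{(x)})=|\Lambda|^{-1}e^{-\beta[H(\sigma^{(x)})-H(\sigma)]_+}$ for $x\in\Lambda$, $P(\sigma,\eta)=0$ if $\eta\neq\sigma$ is not of the form $\sigma^{(x)}$, and $P(\sigma,\sigma)=1-\sum_{\eta\ne\sigma}P(\sigma,\eta)$; it is reversible w.r.t. the Gibbs measure $\mu(\sigma)=e^{-\beta H(\sigma)}/Z$, $Z=\sum_{\eta}e^{-\beta H(\eta)}$. Standing assumption: $0<h<1$, $J\ge2h$, $\frac J{2h}-\frac12\notin\mathbb Z$, and $|\Lambda|\ge(4J/h)^2$. Set $r^*=\lfloor\frac J{2h}-\frac12\rfloor$, $\delta=\frac J{2h}-\frac12-r^*\in(0,1)$, and $\Gamma^{Hex}=-6(r^* )^2h+6r^*J-10r^*h+7J-5h$ if $0<\delta<\frac12$, $\Gamma^{Hex}=-6(r^*+1)^2h+6(r^*+1)J-2(r^*+1)h+3J-h$ if $\frac12<\delta<1$. Metastability notions: a path is a finite sequence $(\omega_1,\dots,\omega_n)$ in $\mathcal X$ with each $\omega_{k+1}=\omega_k^{(x)}$ for some $x\in\Lambda$; $\Theta(\sigma,\eta)$ is the set of paths from $\sigma$ to $\eta$; $\Phi(\sigma,\eta)=\min_{\omega\in\Theta(\sigma,\eta)}\max_{\zeta\in\omega}H(\zeta)$ and $\Phi(A,B)=\min_{\sigma\in A,\eta\in B}\Phi(\sigma,\eta)$. $\mathcal I_\sigma=\{\eta: H(\eta)<H(\sigma)\}$; the stability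 level is $V_\sigma=\Phi(\sigma,\mathcal I_\sigma)-H(\sigma)$ ($V_\sigma=\infty$ if $\mathcal I_\sigma=\emptyset$). $\mathcal X^s$ is the set of global minimisers of $H$, $\Gamma_m=\max_{\sigma\in\mathcal X\setminus\mathcal X^s}V_\sigma$, and $\mathcal X^m=\{\sigma: V_\sigma=\Gamma_m\}$. *)

theory Defs
  imports "HOL-Library.FuncSet" Complex_Main "HOL-Library.Extended_Real"
begin

text \<open>Sites of the hexagonal torus: a triangular face of T^2 in the L x L
parallelogram is (a,b,True) = upward triangle with vertices (a,b),(a+1,b),(a,b+1),
or (a,b,False) = downward triangle with vertices (a+1,b),(a,b+1),(a+1,b+1),
coordinates taken mod L (periodic boundary conditions).\<close>

type_synonym site = "nat \<times> nat \<times> bool"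
type_synonym config = "site \<Rightarrow> int"

definition Lam :: "nat \<Rightarrow> site set" where
  "Lam L = {0..<L} \<times> {0..<L} \<times> UNIV"

text \<open>up(a,b) shares an edge with down(a,b), down(a-1,b), down(a,b-1).\<close>
fun up_down_adj :: "nat \<Rightarrow> site \<Rightarrow> site \<Rightarrow> bool" where
  "up_down_adj L (a, b, u) (c, d, v) =
     (u \<and> \<not> v \<and> ((c, d) = (a, b) \<or> (c, d) = ((a + L - 1) mod L, b)
                       \<or> (c, d) = (a, (b + L - 1) mod L)))"

definition nbr :: "nat \<Rightarrow> site \<Rightarrow> site \<Rightarrow> bool" where
  "nbr L i j = (i \<in> Lam L \<and> j \<in> Lam L \<and> (up_down_adj L i j \<or> up_down_adj L j i))"

definition Conf :: "nat \<Rightarrow> config set" where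
  "Conf L = Lam L \<rightarrow>\<^sub>E {-1, 1}"

definition all_minus :: "nat \<Rightarrow> config" where
  "all_minus L = restrict (\<lambda>_. -1) (Lam L)"

definition all_plus :: "nat \<Rightarrow> config" where
  "all_plus L = restrict (\<lambda>_. 1) (Lam L)"

text \<open>Hamiltonian; the sum over unordered nearest-neighbour pairs equals half
the sum over ordered pairs.\<close>
definition Ham :: "real \<Rightarrow> real \<Rightarrow> nat \<Rightarrow> config \<Rightarrow> real" where
  "Ham J h L \<sigma> =
     - (J / 2) * ((1/2) * (\<Sum>i\<in>Lam L. \<Sum>j\<in>{j \<in> Lam L. nbr L i j}. real_of_int (\<sigma> i * \<sigma> j)))
     - (h / 2) * (\<Sum>i\<in>Lam L. real_of_int (\<sigma> i))"

definition flip :: "config \<Rightarrow> site \<Rightarrow> config" where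
  "flip \<sigma> x = \<sigma>(x := - \<sigma> x)"

definition is_path :: "nat \<Rightarrow> config list \<Rightarrow> bool" where
  "is_path L p = (p \<noteq> [] \<and> set p \<subseteq> Conf L \<and>
      (\<forall>k. Suc k < length p \<longrightarrow> (\<exists>x \<in> Lam L. p ! Suc k = flip (p ! k) x)))"

definition Paths :: "nat \<Rightarrow> config \<Rightarrow> config \<Rightarrow> config list set" where
  "Paths L \<sigma> \<eta> = {p. is_path L p \<and> hd p = \<sigma> \<and> last p = \<eta>}"

definition Phi :: "real \<Rightarrow> real \<Rightarrow> nat \<Rightarrow> config \<Rightarrow> config \<Rightarrow> real" where
  "Phi J h L \<sigma> \<eta> = Min {Max (Ham J h L ` set p) | p. p \<in> Paths L \<sigma> \<eta>}"

definition Phi_set :: "real \<Rightarrow> real \<Rightarrow> nat \<Rightarrow> config set \<Rightarrow> config set \<Rightarrow> real" where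
  "Phi_set J h L A B = Min {Phi J h L \<sigma> \<eta> | \<sigma> \<eta>. \<sigma> \<in> A \<and> \<eta> \<in> B}"

definition Ilow :: "real \<Rightarrow> real \<Rightarrow> nat \<Rightarrow> config \<Rightarrow> config set" where
  "Ilow J h L \<sigma> = {\<eta> \<in> Conf L. Ham J h L \<eta> < Ham J h L \<sigma>}"

definition stab_level :: "real \<Rightarrow> real \<Rightarrow> nat \<Rightarrow> config \<Rightarrow> ereal" where
  "stab_level J h L \<sigma> =
     (if Ilow J h L \<sigma> = {} then \<infinity>
      else ereal (Phi_set J h L {\<sigma>} (Ilow J h L \<sigma>) - Ham J h L \<sigma>))"

definition ground_states :: "real \<Rightarrow> real \<Rightarrow> nat \<Rightarrow> config set" where
  "ground_states J h L = {\<sigma> \<in> Conf L. \<forall>\<eta> \<in> Conf L. Ham J h L \<sigma> \<le> Ham J h L \<eta>}"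

definition Gamma_m :: "real \<Rightarrow> real \<Rightarrow> nat \<Rightarrow> ereal" where
  "Gamma_m J h L = Max (stab_level J h L ` (Conf L - ground_states J h L))"

definition metastable_states :: "real \<Rightarrow> real \<Rightarrow> nat \<Rightarrow> config set" where
  "metastable_states J h L = {\<sigma> \<in> Conf L. stab_level J h L \<sigma> = Gamma_m J h L}"

definition r_star :: "real \<Rightarrow> real \<Rightarrow> int" where
  "r_star J h = \<lfloor>J / (2 * h) - 1/2\<rfloor>"

definition delta :: "real \<Rightarrow> real \<Rightarrow> real" where
  "delta J h = J / (2 * h) - 1/2 - of_int (r_star J h)"

definition Gamma_Hex :: "real \<Rightarrow> real \<Rightarrow> real" where
  "Gamma_Hex J h =
     (let r = real_of_int (r_star J h) in
      if delta J h < 1/2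
      then - 6 * r^2 * h + 6 * r * J - 10 * r * h + 7 * J - 5 * h
      else - 6 * (r + 1)^2 * h + 6 * (r + 1) * J - 2 * (r + 1) * h + 3 * J - h)"

end

theory Submission
  imports Defs
begin

text \<open>
  Write \<open>S\<close> for the set of plus spins and \<open>E S = J * per S - h * card S\<close> for its energy
  relative to the all-minus state.

  Isoperimetry. Every strip of faces that meets a finite planar set \<open>S\<close> contains at least two
  boundary edges, and every edge lies in two strips, so \<open>per S\<close> is at least the number of strips
  met in the three directions. A rearrangement bound for the number of faces in given strips then
  gives \<open>6 * card S \<le> (per S)\<^sup>2\<close>, the rounding loss being recovered by parity. On the torus, a
  set avoiding some row and some column lifts to the plane; otherwise nearly every row (or column)
  is cut and the perimeter is of order \<open>2 * L\<close>. Any path from all-minus to a lower energy passes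
  through the critical cardinality, where isoperimetry forces energy at least the critical one.

  Reference path. Growing hexagons bar by bar yields a list of faces whose initial segments have
  least perimeter, hence energy at most the critical one; it is stopped at a hexagon whose energy is
  below that of each of its proper subsets. For a nonempty \<open>S\<close>, start such a spiral
  \<open>A\<^sub>0 \<subseteq> A\<^sub>1 \<subseteq> \<dots> \<subseteq> A\<^sub>N\<close> at a site of \<open>S\<close>. Submodularity gives
  \<open>E (S \<union> A\<^sub>k) - E S \<le> E A\<^sub>k - E (S \<inter> A\<^sub>k)\<close>, which stays strictly below the critical
  energy and is negative for \<open>k = N\<close> unless \<open>A\<^sub>N \<subseteq> S\<close>. If \<open>A\<^sub>N \<subseteq> S\<close> for every starting
  site in \<open>S\<close>, then \<open>S\<close> is closed under neighbours and is the whole torus.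
\<close>

section \<open>Faces, their neighbours, and the perimeter of a set of faces\<close>

type_synonym face = "int \<times> int \<times> bool"

text \<open>The index names the direction of the shared edge, so each \<open>nb i\<close> is an
  involution exchanging the two orientations. All indices from 2 on denote the third direction, so
  these laws hold for every \<open>i\<close>.\<close>

fun nb :: "nat \<Rightarrow> face \<Rightarrow> face" where
  "nb i (a, b, u) =
     (if i = 0 then (a, b, \<not> u)
      else if i = 1 then (if u then (a - 1, b, False) else (a + 1, b, True))
      else (if u then (a, b - 1, False) else (a, b + 1, True)))"

text \<open>For neighbour maps \<open>n 0\<close>, \<open>n 1\<close>, \<open>n 2\<close> this counts
  each boundary edge once, at its end in \<open>S\<close>.\<close>
definition per :: "(nat \<Rightarrow> 'a \<Rightarrow> 'a) \<Rightarrow> 'a set \<Rightarrow> nat" where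
  "per n S = (\<Sum>i<3. card {x \<in> S. n i x \<notin> S})"

lemma sum3: "(\<Sum>i<3. f i) = f 0 + f 1 + f (2::nat)"
  for f :: "nat \<Rightarrow> 'a::comm_monoid_add"
  by (simp add: numeral_3_eq_3 numeral_2_eq_2)

lemma ex_less3: "(\<exists>i<3. P i) \<longleftrightarrow> P 0 \<or> P 1 \<or> P (2::nat)"
  by (auto simp: numeral_3_eq_3 numeral_2_eq_2 less_Suc_eq)

lemma nb_nb [simp]: "nb i (nb i f) = f"
  by (cases f) auto

lemma nb_colour [simp]: "snd (snd (nb i f)) = (\<not> snd (snd f))"
  by (cases f) simp

lemma per_empty [simp]: "per n {} = 0"
  by (simp add: per_def)

text \<open>Cut functions of graphs are submodular. In each direction the boundary sets of
  \<open>A \<union> B\<close> and \<open>A \<inter> B\<close> have their union and their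
  intersection inside the union and the intersection of the boundary sets of \<open>A\<close> and
  \<open>B\<close>.\<close>

lemma per_submodular:
  assumes "finite A" "finite B"
  shows "per n (A \<union> B) + per n (A \<inter> B) \<le> per n A + per n B"
proof -
  have "card {x \<in> A \<union> B. n i x \<notin> A \<union> B} + card {x \<in> A \<inter> B. n i x \<notin> A \<inter> B}
      \<le> card {x \<in> A. n i x \<notin> A} + card {x \<in> B. n i x \<notin> B}" for i
  proof -
    let ?U = "{x \<in> A \<union> B. n i x \<notin> A \<union> B}" and ?I = "{x \<in> A \<inter> B. n i x \<notin> A \<inter> B}"
    let ?A = "{x \<in> A. n i x \<notin> A}" and ?B = "{x \<in> B. n i x \<notin> B}"
    have "card ?U + card ?I = card (?U \<union> ?I) + card (?U \<inter> ?I)"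
      using assms by (intro card_Un_Int) auto
    also have "\<dots> \<le> card (?A \<union> ?B) + card (?A \<inter> ?B)"
      using assms by (intro add_mono card_mono) auto
    also have "\<dots> = card ?A + card ?B"
      using assms by (intro card_Un_Int [symmetric]) auto
    finally show ?thesis .
  qed
  then show ?thesis
    by (simp add: per_def sum.distrib [symmetric] sum_mono)
qed

text \<open>The involution \<open>m\<close> matches the inner elements of one colour with those of
  the other.\<close>

lemma even_card_inner:
  assumes "finite S" and inv: "\<And>x. x \<in> S \<Longrightarrow> m (m x) = x" and col: "\<And>x. x \<in> S \<Longrightarrow> c (m x) = (\<not> c x)"
  shows "even (card {x \<in> S. m x \<in> S})"
proof -
  let ?P = "{x \<in> S. m x \<in> S \<and> c x}" and ?Q = "{x \<in> S. m x \<in> S \<and> \<not> c x}"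
  have "bij_betw m ?P ?Q"
    by (rule bij_betw_byWitness [where f' = m]) (use inv col in auto)
  then have "card ?P = card ?Q" by (rule bij_betw_same_card)
  moreover have "card {x \<in> S. m x \<in> S} = card (?P \<union> ?Q)"
    by (rule arg_cong [where f = card]) auto
  moreover have "card (?P \<union> ?Q) = card ?P + card ?Q"
    using assms(1) by (intro card_Un_disjoint) auto
  ultimately show ?thesis by simp
qed

text \<open>In each direction the inner elements are even in number, so the boundary count has the
  parity of \<open>card S\<close>; the sum of three such counts has it too.\<close>

lemma per_parity:
  assumes "finite S" and inv: "\<And>i x. x \<in> S \<Longrightarrow> n i (n i x) = x"
    and col: "\<And>i x. x \<in> S \<Longrightarrow> c (n i x) = (\<not> c x)"
  shows "even (per n S) = even (card S)"
proof -
  have "even (card {x \<in> S. n i x \<notin> S}) = even (card S)" for i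
  proof -
    have "card S = card ({x \<in> S. n i x \<in> S} \<union> {x \<in> S. n i x \<notin> S})"
      by (rule arg_cong [where f = card]) auto
    also have "\<dots> = card {x \<in> S. n i x \<in> S} + card {x \<in> S. n i x \<notin> S}"
      using assms(1) by (intro card_Un_disjoint) auto
    finally show ?thesis
      using even_card_inner [of S "n i" c] assms by auto
  qed
  then show ?thesis by (auto simp: per_def sum3)
qed

text \<open>An edge from \<open>y\<close> into \<open>A\<close> stops being a boundary edge, any
  other edge of \<open>y\<close> becomes one. With \<open>e\<close> edges of the first kind the
  count changes by \<open>(3 - e) - e\<close>.\<close>

lemma per_insert:
  assumes "finite A" "y \<notin> A" and inv: "\<And>i x. n i (n i x) = x" and fpf: "\<And>i x. n i x \<noteq> x"
  shows "int (per n (insert y A)) = int (per n A) + 3 - 2 * (\<Sum>i<3. if n i y \<in> A then 1 else 0)"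
proof -
  have eq: "n i x = y \<longleftrightarrow> x = n i y" for i x using inv by metis
  have "int (card {x \<in> insert y A. n i x \<notin> insert y A})
      = int (card {x \<in> A. n i x \<notin> A}) + 1 - 2 * (if n i y \<in> A then 1 else 0)" for i
  proof (cases "n i y \<in> A")
    case True
    have e: "{x \<in> insert y A. n i x \<notin> insert y A} = {x \<in> A. n i x \<notin> A} - {n i y}"
      using True fpf [of i y] by (auto simp: eq)
    have "n i y \<in> {x \<in> A. n i x \<notin> A}" using True inv assms by auto
    moreover have "finite {x \<in> A. n i x \<notin> A}" using assms by auto
    ultimately have "Suc (card ({x \<in> A. n i x \<notin> A} - {n i y})) = card {x \<in> A. n i x \<notin> A}"
      by (rule card.remove [symmetric, rotated])
    then show ?thesis unfolding e using True by simp
  next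
    case False
    have "{x \<in> insert y A. n i x \<notin> insert y A} = insert y {x \<in> A. n i x \<notin> A}"
      using False fpf [of i y] by (auto simp: eq)
    then show ?thesis using False assms by simp
  qed
  then show ?thesis by (simp add: per_def sum3)
qed

subsection \<open>Isoperimetry in the plane\<close>

text \<open>A finite strip is left upwards at its largest element and downwards at its
  smallest.\<close>

lemma card_strips_le:
  fixes T :: "(int \<times> int) set"
  assumes "finite T"
  shows "card (fst ` T) \<le> card {p \<in> T. (fst p, snd p + 1) \<notin> T}"
    and "card (fst ` T) \<le> card {p \<in> T. (fst p, snd p - 1) \<notin> T}"
proof -
  have "fst ` T \<subseteq> fst ` {p \<in> T. (fst p, snd p + 1) \<notin> T}"
  proof
    fix s assume "s \<in> fst ` T"
    let ?P = "{t. (s, t) \<in> T}"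
    have "?P \<subseteq> snd ` T" by force
    then have fin: "finite ?P" using assms by (meson finite_imageI finite_subset)
    have ne: "?P \<noteq> {}" using \<open>s \<in> fst ` T\<close> by force
    have "Max ?P \<in> ?P" using fin ne by (rule Max_in)
    moreover have "Max ?P + 1 \<notin> ?P" using Max_ge [OF fin, of "Max ?P + 1"] by auto
    ultimately show "s \<in> fst ` {p \<in> T. (fst p, snd p + 1) \<notin> T}"
      by (force intro: image_eqI [where x = "(s, Max ?P)"])
  qed
  then show "card (fst ` T) \<le> card {p \<in> T. (fst p, snd p + 1) \<notin> T}"
    using assms by (intro surj_card_le) auto
  have "fst ` T \<subseteq> fst ` {p \<in> T. (fst p, snd p - 1) \<notin> T}"
  proof
    fix s assume "s \<in> fst ` T"
    let ?P = "{t. (s, t) \<in> T}"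
    have "?P \<subseteq> snd ` T" by force
    then have fin: "finite ?P" using assms by (meson finite_imageI finite_subset)
    have ne: "?P \<noteq> {}" using \<open>s \<in> fst ` T\<close> by force
    have "Min ?P \<in> ?P" using fin ne by (rule Min_in)
    moreover have "Min ?P - 1 \<notin> ?P" using Min_le [OF fin, of "Min ?P - 1"] by auto
    ultimately show "s \<in> fst ` {p \<in> T. (fst p, snd p - 1) \<notin> T}"
      by (force intro: image_eqI [where x = "(s, Min ?P)"])
  qed
  then show "card (fst ` T) \<le> card {p \<in> T. (fst p, snd p - 1) \<notin> T}"
    using assms by (intro surj_card_le) auto
qed

text \<open>A strip \<open>s\<close> enumerates its faces by \<open>t \<mapsto> e (s, t)\<close>; consecutive faces
  are exchanged alternately by \<open>nb p\<close> and \<open>nb q\<close>.\<close>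
lemma strips_le_per:
  fixes e :: "int \<times> int \<Rightarrow> face"
  assumes fin: "finite T" and ee': "\<And>x. e (e' x) = x" and e'e: "\<And>y. e' (e y) = y"
    and right: "\<And>s t. e (s, t + 1) = nb (if snd (snd (e (s, t))) then p else q) (e (s, t))"
  shows "2 * card ((fst \<circ> e') ` T) \<le> card {x \<in> T. nb p x \<notin> T} + card {x \<in> T. nb q x \<notin> T}"
proof -
  let ?u = "\<lambda>x::face. snd (snd x)"
  \<comment> \<open>Backwards along the strip \<open>p\<close> and \<open>q\<close> change roles,
    because neighbours have opposite orientations.\<close>
  have left: "e (s, t - 1) = nb (if ?u (e (s, t)) then q else p) (e (s, t))" for s t
    using right [of s "t - 1"] by (cases "?u (e (s, t - 1))") simp_all
  let ?T = "e' ` T"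
  have mem: "y \<in> ?T \<longleftrightarrow> e y \<in> T" for y
    using ee' e'e by (metis imageE image_eqI)
  have inj: "inj_on e X" for X by (metis e'e inj_on_inverseI)
  have R: "card {y \<in> ?T. (fst y, snd y + 1) \<notin> ?T}
      = card ({x \<in> T. ?u x \<and> nb p x \<notin> T} \<union> {x \<in> T. \<not> ?u x \<and> nb q x \<notin> T})" (is "card ?A = card ?B")
  proof -
    have "e ` ?A = ?B"
    proof (intro equalityI subsetI)
      fix x assume "x \<in> ?B"
      moreover obtain s t where x: "x = e (s, t)" by (metis ee' surj_pair)
      ultimately have "(s, t) \<in> ?A" by (auto simp: mem right)
      then show "x \<in> e ` ?A" unfolding x by (rule imageI)
    next
      fix x assume "x \<in> e ` ?A"
      then obtain y where "x = e y" "y \<in> ?A" by (rule imageE)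
      moreover obtain s t where "y = (s, t)" by (cases y)
      ultimately have "x = e (s, t)" "(s, t) \<in> ?A" by simp_all
      then show "x \<in> ?B" by (cases "?u x") (auto simp: mem right)
    qed
    then show ?thesis using card_image [OF inj, of ?A] by simp
  qed
  have L: "card {y \<in> ?T. (fst y, snd y - 1) \<notin> ?T}
      = card ({x \<in> T. ?u x \<and> nb q x \<notin> T} \<union> {x \<in> T. \<not> ?u x \<and> nb p x \<notin> T})" (is "card ?A = card ?B")
  proof -
    have "e ` ?A = ?B"
    proof (intro equalityI subsetI)
      fix x assume "x \<in> ?B"
      moreover obtain s t where x: "x = e (s, t)" by (metis ee' surj_pair)
      ultimately have "(s, t) \<in> ?A" by (auto simp: mem left)
      then show "x \<in> e ` ?A" unfolding x by (rule imageI)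
    next
      fix x assume "x \<in> e ` ?A"
      then obtain y where "x = e y" "y \<in> ?A" by (rule imageE)
      moreover obtain s t where "y = (s, t)" by (cases y)
      ultimately have "x = e (s, t)" "(s, t) \<in> ?A" by simp_all
      then show "x \<in> ?B" by (cases "?u x") (auto simp: mem left)
    qed
    then show ?thesis using card_image [OF inj, of ?A] by simp
  qed
  have split: "card {x \<in> T. nb i x \<notin> T}
      = card {x \<in> T. ?u x \<and> nb i x \<notin> T} + card {x \<in> T. \<not> ?u x \<and> nb i x \<notin> T}" for i
  proof -
    have "{x \<in> T. nb i x \<notin> T} = {x \<in> T. ?u x \<and> nb i x \<notin> T} \<union> {x \<in> T. \<not> ?u x \<and> nb i x \<notin> T}" by auto
    then show ?thesis using fin by (simp only:) (intro card_Un_disjoint, auto)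
  qed
  have "card {y \<in> ?T. (fst y, snd y + 1) \<notin> ?T}
      = card {x \<in> T. ?u x \<and> nb p x \<notin> T} + card {x \<in> T. \<not> ?u x \<and> nb q x \<notin> T}"
    unfolding R using fin by (intro card_Un_disjoint) auto
  moreover have "card {y \<in> ?T. (fst y, snd y - 1) \<notin> ?T}
      = card {x \<in> T. ?u x \<and> nb q x \<notin> T} + card {x \<in> T. \<not> ?u x \<and> nb p x \<notin> T}"
    unfolding L using fin by (intro card_Un_disjoint) auto
  moreover have "card (fst ` ?T) \<le> card {y \<in> ?T. (fst y, snd y + 1) \<notin> ?T}"
    "card (fst ` ?T) \<le> card {y \<in> ?T. (fst y, snd y - 1) \<notin> ?T}"
    using card_strips_le [of ?T] fin by auto
  ultimately show ?thesis
    by (simp add: split image_comp)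
qed

text \<open>The index of the strip in the third lattice direction; the other two are the coordinates.\<close>
definition diag :: "face \<Rightarrow> int" where
  "diag f = fst f + fst (snd f) + (if snd (snd f) then 0 else 1)"

text \<open>Edges of each direction are crossed by two of the three families of strips, so adding
  the three instances of \<open>strips_le_per\<close> counts the perimeter twice.\<close>

lemma per_ge_strips:
  assumes fin: "finite T"
  shows "card (fst ` T) + card ((fst \<circ> snd) ` T) + card (diag ` T) \<le> per nb T"
proof -
  \<comment> \<open>Even positions of a strip are upward faces and odd positions downward ones, in
    all three families.\<close>
  let ?row = "\<lambda>(s, t). (t div 2, s, even t) :: face"
  let ?row' = "\<lambda>f. (fst (snd f), 2 * fst f + (if snd (snd f) then 0 else 1)) :: int \<times> int"
  let ?col = "\<lambda>(s, t). (s, t div 2, even t) :: face"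
  let ?col' = "\<lambda>f. (fst f, 2 * fst (snd f) + (if snd (snd f) then 0 else 1)) :: int \<times> int"
  let ?dia = "\<lambda>(s, t). (t div 2, s - t div 2 - t mod 2, even t) :: face"
  let ?dia' = "\<lambda>f. (diag f, 2 * fst f + (if snd (snd f) then 0 else 1)) :: int \<times> int"
  have div: "(t + 1) div 2 = (if even t then t div 2 else t div 2 + 1)" for t :: int by presburger
  have "2 * card ((fst \<circ> ?row') ` T) \<le> card {x \<in> T. nb 0 x \<notin> T} + card {x \<in> T. nb 1 x \<notin> T}"
    by (rule strips_le_per [OF fin, where e = ?row]) (auto simp: div)
  moreover have "2 * card ((fst \<circ> ?col') ` T) \<le> card {x \<in> T. nb 0 x \<notin> T} + card {x \<in> T. nb 2 x \<notin> T}"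
    by (rule strips_le_per [OF fin, where e = ?col]) (auto simp: div)
  moreover have "2 * card ((fst \<circ> ?dia') ` T) \<le> card {x \<in> T. nb 2 x \<notin> T} + card {x \<in> T. nb 1 x \<notin> T}"
    by (rule strips_le_per [OF fin, where e = ?dia]) (auto simp: div diag_def odd_iff_mod_2_eq_one)
  ultimately show ?thesis
    by (simp add: per_def sum3 o_def)
qed

text \<open>The faces in the first column or the last row of \<open>A \<times> B\<close> are determined by
  their diagonal strip and their orientation, so there are at most \<open>2 * card D\<close> of them;
  removing this hook \<open>c\<close> times gives the bound.\<close>
lemma card_le_hooks:
  assumes "finite A" "finite B" "finite D"
    and "T \<subseteq> {f. fst f \<in> A \<and> fst (snd f) \<in> B \<and> diag f \<in> D}"
    and "c \<le> card A" "c \<le> card B"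
  shows "card T \<le> 2 * (c * card D + (card A - c) * (card B - c))"
  using assms
proof (induction c arbitrary: A B T)
  case 0
  have "T \<subseteq> A \<times> B \<times> UNIV" using 0 by auto
  then have "card T \<le> card (A \<times> B \<times> (UNIV :: bool set))"
    using 0 by (intro card_mono) auto
  then show ?case by (simp add: card_cartesian_product)
next
  case (Suc c)
  have ne: "A \<noteq> {}" "B \<noteq> {}" using Suc.prems by auto
  let ?H = "{f \<in> T. fst f = Min A \<or> fst (snd f) = Max B}"
  have finT: "finite T"
    by (rule finite_subset [of _ "A \<times> B \<times> UNIV"]) (use Suc.prems in auto)
  have "inj_on (\<lambda>f. (diag f, snd (snd f))) ?H"
  proof (rule inj_onI)
    fix f g assume f: "f \<in> ?H" and g: "g \<in> ?H" and eq: "(diag f, snd (snd f)) = (diag g, snd (snd g))"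
    have "Min A \<le> fst f" "Min A \<le> fst g" "fst (snd f) \<le> Max B" "fst (snd g) \<le> Max B"
      using f g Suc.prems by auto
    then show "f = g" using f g eq by (cases f; cases g) (auto simp: diag_def)
  qed
  then have "card ?H = card ((\<lambda>f. (diag f, snd (snd f))) ` ?H)" by (simp add: card_image)
  also have "\<dots> \<le> card (D \<times> (UNIV :: bool set))"
    using Suc.prems by (intro card_mono) auto
  finally have H: "card ?H \<le> 2 * card D" by (simp add: card_cartesian_product)
  have "card (T - ?H) \<le> 2 * (c * card D + (card (A - {Min A}) - c) * (card (B - {Max B}) - c))"
    using Suc.prems ne by (intro Suc.IH) auto
  moreover have "card (A - {Min A}) = card A - 1" "card (B - {Max B}) = card B - 1"
    using Suc.prems ne by auto
  moreover have "card T = card ?H + card (T - ?H)"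
    using card_Int_Diff [OF finT, of ?H] by (simp add: Int_absorb1)
  ultimately show ?case using H by (simp add: algebra_simps)
qed

text \<open>If one of the strip numbers is at least the sum of the others, the other two bound a
  parallelogram. Otherwise the hypothesis is used with the best number \<open>c\<close> of removed
  hooks.\<close>

lemma hexagon_area_bound:
  fixes s1 s2 s3 n :: nat
  assumes "\<And>c. c \<le> s1 \<Longrightarrow> c \<le> s2 \<Longrightarrow> n \<le> 2 * (c * s3 + (s1 - c) * (s2 - c))"
  shows "6 * n \<le> (s1 + s2 + s3)^2 + 3"
proof -
  have far: "6 * n \<le> (s1 + s2 + s3)^2 + 3" if "x + y \<le> z" "n \<le> 2 * (x * y)" "x + y + z = s1 + s2 + s3" for x y z
  proof -
    have "0 \<le> (int x - int y)^2 + (int x)^2 + (int y)^2" by simp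
    then have "int (12 * (x * y)) \<le> int ((2 * (x + y))^2)"
      by (simp add: power2_eq_square algebra_simps)
    then have "12 * (x * y) \<le> (2 * (x + y))^2" by (simp only: of_nat_le_iff)
    also have "\<dots> \<le> (x + y + z)^2" using that by (intro power_mono) auto
    finally show ?thesis using that by simp
  qed
  consider "s1 + s2 \<le> s3" | "s1 + s3 \<le> s2" | "s2 + s3 \<le> s1"
    | "s3 < s1 + s2" "s2 < s1 + s3" "s1 < s2 + s3" by linarith
  then show ?thesis
  proof cases
    case 1 then show ?thesis using far [of s1 s2 s3] assms [of 0] by simp
  next
    case 2 then show ?thesis using far [of s1 s3 s2] assms [of s1] by simp
  next
    case 3 then show ?thesis using far [of s2 s3 s1] assms [of s2] by (simp add: ac_simps)
  next
    case 4
    \<comment> \<open>The real minimiser of the bound is \<open>(s1 + s2 - s3) / 2\<close>;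
      \<open>c\<close> is its integer part and \<open>e\<close> records the rounding.\<close>
    define c where "c = (s1 + s2 - s3) div 2"
    define p q e where "p = int s1 - int c" and "q = int s2 - int c" and "e = int ((s1 + s2 - s3) mod 2)"
    have c: "c \<le> s1" "c \<le> s2" unfolding c_def using 4 by linarith+
    have "s1 + s2 - s3 = 2 * c + nat e" unfolding c_def e_def by simp
    then have s3: "int s3 = p + q - e" unfolding p_def q_def using 4 e_def by linarith
    have e: "e = 0 \<or> e = 1" unfolding e_def by linarith
    have "int n \<le> int (2 * (c * s3 + (s1 - c) * (s2 - c)))"
      using assms [OF c] by linarith
    also have "\<dots> = 2 * (int c * (p + q - e) + p * q)"
      using c by (simp add: s3 p_def q_def of_nat_diff)
    finally have n: "int n \<le> 2 * (int c * (p + q - e) + p * q)" .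
    have s: "int (s1 + s2 + s3) = 2 * (p + q + int c) - e" by (simp add: s3 p_def q_def)
    define u v where "u = p - int c" and "v = q - int c"
    \<comment> \<open>Twice this sum is the difference of the two sides of the next inequality if
      \<open>e = 1\<close>, and 3 less than it if \<open>e = 0\<close>. The summand 3 is thus the
      price of rounding.\<close>
    have "0 \<le> (u - v)^2 + (u - e)^2 + (v - e)^2" by simp
    then have "12 * (int c * (p + q - e) + p * q) \<le> (2 * (p + q + int c) - e)^2 + 3"
      using e unfolding u_def v_def by (auto simp: power2_eq_square algebra_simps)
    then have "6 * int n \<le> (int (s1 + s2 + s3))^2 + 3" using n unfolding s by linarith
    then have "int (6 * n) \<le> int ((s1 + s2 + s3)^2 + 3)" by simp
    then show ?thesis by (simp only: of_nat_le_iff)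
  qed
qed

text \<open>The slack could be used only if \<open>6 * n\<close> is \<open>p^2 + 2\<close> with
  \<open>p\<close> congruent to 2 or 4 modulo 6, or \<open>p^2 + 3\<close> with \<open>p\<close>
  congruent to 3. In both cases \<open>n\<close> would have the parity opposite to that of
  \<open>p\<close>.\<close>

lemma isoperimetry_arith:
  fixes n p :: int
  assumes "6 * n \<le> p^2 + 3" "even p = even n"
  shows "6 * n \<le> p^2"
proof -
  define q i where "q = p div 6" and "i = p mod 6"
  have p: "p = 6 * q + i" by (simp add: q_def i_def)
  have "i \<in> {0..<6}" by (simp add: i_def)
  then have "i \<in> {0, 1, 2, 3, 4, 5}" by auto
  moreover have "p^2 = 36 * (q * q) + 12 * (q * i) + i * i"
    by (simp add: p power2_eq_square algebra_simps)
  moreover obtain m where "q * q = m" by simp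
  moreover obtain P where P: "p^2 = P" by simp
  ultimately consider "i = 0" "P = 36 * m" | "i = 1" "P = 36 * m + 12 * q + 1"
    | "i = 2" "P = 36 * m + 24 * q + 4" | "i = 3" "P = 36 * m + 36 * q + 9"
    | "i = 4" "P = 36 * m + 48 * q + 16" | "i = 5" "P = 36 * m + 60 * q + 25"
    by auto
  then show ?thesis
    using assms p unfolding P by cases presburger+
qed

lemma planar_isoperimetry:
  assumes fin: "finite T"
  shows "6 * card T \<le> (per nb T)^2"
proof -
  let ?a = "card (fst ` T)" and ?b = "card ((fst \<circ> snd) ` T)" and ?d = "card (diag ` T)"
  have "6 * card T \<le> (?a + ?b + ?d)^2 + 3"
    by (rule hexagon_area_bound, rule card_le_hooks) (use fin in auto)
  also have "\<dots> \<le> (per nb T)^2 + 3"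
    using per_ge_strips [OF fin] by (simp add: power_mono)
  finally have "int (6 * card T) \<le> int ((per nb T)^2 + 3)" by (simp only: of_nat_le_iff)
  then have "6 * int (card T) \<le> (int (per nb T))^2 + 3" by simp
  moreover have "even (per nb T) = even (card T)"
    by (rule per_parity [where c = "\<lambda>f. snd (snd f)"]) (use fin in \<open>auto simp del: nb.simps\<close>)
  ultimately have "6 * int (card T) \<le> (int (per nb T))^2"
    by (intro isoperimetry_arith) auto
  then have "int (6 * card T) \<le> int ((per nb T)^2)" by simp
  then show ?thesis by (simp only: of_nat_le_iff)
qed

subsection \<open>The torus\<close>

fun proj :: "nat \<Rightarrow> face \<Rightarrow> site" where
  "proj L (a, b, u) = (nat (a mod int L), nat (b mod int L), u)"

fun lift :: "site \<Rightarrow> face" where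
  "lift (a, b, u) = (int a, int b, u)"

definition tnb :: "nat \<Rightarrow> nat \<Rightarrow> site \<Rightarrow> site" where
  "tnb L i x = proj L (nb i (lift x))"

lemma finite_Lam [simp]: "finite (Lam L)"
  by (simp add: Lam_def)

lemma card_Lam: "card (Lam L) = 2 * L^2"
  by (simp add: Lam_def card_cartesian_product power2_eq_square)

lemma proj_eq_iff:
  assumes "L > 0"
  shows "proj L (a, b, u) = proj L (c, d, v)
    \<longleftrightarrow> a mod int L = c mod int L \<and> b mod int L = d mod int L \<and> u = v"
  using assms by (simp add: nat_eq_iff)

lemma proj_in_Lam [simp]: "L > 0 \<Longrightarrow> proj L f \<in> Lam L"
  by (cases f) (simp add: Lam_def nat_less_iff)

lemma proj_lift [simp]: "x \<in> Lam L \<Longrightarrow> proj L (lift x) = x"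
  by (cases x) (simp add: Lam_def)

lemma tnb_proj:
  assumes "L > 0"
  shows "tnb L i (proj L f) = proj L (nb i f)"
proof -
  obtain a b u where f: "f = (a, b, u)" by (cases f)
  have "int (nat (c mod int L)) = c mod int L" for c using assms by simp
  then show ?thesis
    unfolding tnb_def f using assms
    by (simp add: proj_eq_iff del: proj.simps) (simp add: mod_simps)
qed

lemma tnb_in_Lam [simp]: "L > 0 \<Longrightarrow> tnb L i x \<in> Lam L"
  by (simp add: tnb_def)

lemma tnb_tnb [simp]:
  assumes "L > 0" "x \<in> Lam L"
  shows "tnb L i (tnb L i x) = x"
  using assms by (simp add: tnb_def [of L i x] tnb_proj)

lemma tnb_colour [simp]: "snd (snd (tnb L i x)) = (\<not> snd (snd x))"
  unfolding tnb_def by (cases "nb i (lift x)"; cases x) (auto split: if_splits)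

lemma per_parity_torus:
  assumes "L > 0" "S \<subseteq> Lam L"
  shows "even (per (tnb L) S) = even (card S)"
  by (rule per_parity [where c = "\<lambda>f. snd (snd f)"]) (use assms in \<open>auto intro: finite_subset [OF _ finite_Lam]\<close>)

text \<open>Brings the neighbour maps into the form in which \<open>up_down_adj\<close> describes
  adjacency.\<close>

lemma tnb_cases:
  assumes "L \<ge> 2" "a < L" "b < L"
  shows "tnb L 0 (a, b, u) = (a, b, \<not> u)"
    and "tnb L 1 (a, b, True) = ((a + L - 1) mod L, b, False)"
    and "tnb L 2 (a, b, True) = (a, (b + L - 1) mod L, False)"
    and "tnb L 1 (a, b, False) = ((a + 1) mod L, b, True)"
    and "tnb L 2 (a, b, False) = (a, (b + 1) mod L, True)"
proof -
  have pred: "nat ((int c - 1) mod int L) = (c + L - 1) mod L" for c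
  proof -
    have "(int c - 1) mod int L = (int c - 1 + int L) mod int L" by simp
    also have "\<dots> = int ((c + L - 1) mod L)"
      using assms by (simp add: zmod_int of_nat_diff algebra_simps)
    finally show ?thesis by simp
  qed
  have succ: "nat ((int c + 1) mod int L) = (c + 1) mod L" for c
  proof -
    have "(int c + 1) mod int L = int ((c + 1) mod L)" by (simp add: zmod_int add.commute)
    then show ?thesis by simp
  qed
  show "tnb L 0 (a, b, u) = (a, b, \<not> u)"
    "tnb L 1 (a, b, True) = ((a + L - 1) mod L, b, False)"
    "tnb L 2 (a, b, True) = (a, (b + L - 1) mod L, False)"
    "tnb L 1 (a, b, False) = ((a + 1) mod L, b, True)"
    "tnb L 2 (a, b, False) = (a, (b + 1) mod L, True)"
    using assms by (simp_all add: tnb_def pred succ)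
qed

lemma mod_pred_iff:
  fixes L :: nat
  assumes "a < L" "c < L"
  shows "c = (a + L - 1) mod L \<longleftrightarrow> a = (c + 1) mod L"
proof -
  have "(a + L - 1) mod L = (if a = 0 then L - 1 else a - 1)"
    using assms by (auto simp: mod_if)
  moreover have "(c + 1) mod L = (if c = L - 1 then 0 else c + 1)"
    using assms by (auto simp: mod_if)
  ultimately show ?thesis using assms by auto
qed

lemma nbr_iff_tnb:
  assumes "L \<ge> 2" "x \<in> Lam L" "y \<in> Lam L"
  shows "nbr L x y \<longleftrightarrow> (\<exists>i<3. y = tnb L i x)"
proof -
  obtain a b u c d v where x: "x = (a, b, u)" and y: "y = (c, d, v)" by (cases x; cases y) auto
  have lt: "a < L" "b < L" "c < L" "d < L" using assms by (auto simp: x y Lam_def)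
  have step: "(a = (c + L - 1) mod L) = (c = (a + 1) mod L)" "(b = (d + L - 1) mod L) = (d = (b + 1) mod L)"
    using mod_pred_iff lt by blast+
  have mem: "(a, b, u) \<in> Lam L" "(c, d, v) \<in> Lam L" using assms x y by auto
  show ?thesis
    unfolding ex_less3 nbr_def x y using mem
    by (cases u; cases v; simp only: tnb_cases [OF assms(1) lt(1,2)] up_down_adj.simps prod.inject step
        simp_thms eq_commute [of c a] eq_commute [of d b])
qed

text \<open>From \<open>L = 2\<close> on a cyclic step moves a coordinate, so the three neighbours
  differ and sums over neighbours become sums over directions.\<close>

lemma inj_on_tnb:
  assumes "L \<ge> 2" "x \<in> Lam L"
  shows "inj_on (\<lambda>i. tnb L i x) {..<3}"
proof -
  obtain a b u where x: "x = (a, b, u)" by (cases x) auto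
  have lt: "a < L" "b < L" using assms by (auto simp: x Lam_def)
  have ne: "(c + 1) mod L \<noteq> c" "(c + L - 1) mod L \<noteq> c" if "c < L" for c
    using that assms by (auto simp: mod_if)
  note ne [OF lt(1)] ne [OF lt(1), symmetric] ne [OF lt(2)] ne [OF lt(2), symmetric]
  then have "tnb L 0 x \<noteq> tnb L 1 x \<and> tnb L 0 x \<noteq> tnb L 2 x \<and> tnb L 1 x \<noteq> tnb L 2 x"
    by (cases u; simp only: x tnb_cases [OF assms(1) lt] prod.inject simp_thms)+
  then show ?thesis
    by (auto simp: inj_on_def numeral_3_eq_3 less_Suc_eq numeral_2_eq_2)
qed

lemma sum_nbr:
  assumes "L \<ge> 2" "x \<in> Lam L"
  shows "(\<Sum>j\<in>{j \<in> Lam L. nbr L x j}. F j) = (\<Sum>i<3. F (tnb L i x))"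
proof -
  have "{j \<in> Lam L. nbr L x j} = (\<lambda>i. tnb L i x) ` {..<3}"
    using assms by (auto simp: nbr_iff_tnb)
  then show ?thesis
    by (simp add: sum.reindex [OF inj_on_tnb [OF assms]])
qed

section \<open>Lifting sets from the torus to the plane\<close>

definition window :: "int \<Rightarrow> int \<Rightarrow> int \<Rightarrow> face set" where
  "window w x y = {f. x \<le> fst f \<and> fst f < x + w \<and> y \<le> fst (snd f) \<and> fst (snd f) < y + w}"

lemma finite_window [simp]: "finite (window w x y)"
  by (rule finite_subset [of _ "{x..<x+w} \<times> {y..<y+w} \<times> UNIV"]) (auto simp: window_def)

lemma mod_eq_near:
  fixes x y :: int
  assumes "x mod l = y mod l" "\<bar>x - y\<bar> < l"
  shows "x = y"
  using assms dvd_imp_le_int [of "x - y" l] by (force simp: mod_eq_dvd_iff)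

lemma inj_on_proj_window:
  assumes "w < int L"
  shows "inj_on (proj L) (window w x y)"
proof (rule inj_onI)
  fix f g assume f: "f \<in> window w x y" and g: "g \<in> window w x y" and e: "proj L f = proj L g"
  obtain a b u c d v where fg: "f = (a, b, u)" "g = (c, d, v)" by (cases f; cases g)
  have "L > 0" using f assms by (auto simp: window_def)
  then have "a mod int L = c mod int L \<and> b mod int L = d mod int L \<and> u = v"
    using e by (simp only: fg proj_eq_iff)
  then show "f = g" using f g assms unfolding fg
    by (auto intro!: mod_eq_near [of _ "int L"] simp: window_def)
qed

text \<open>A neighbour of a window face lies at most one step outside, so its coordinates differ
  from those of any window face by at most \<open>w\<close>, which is less than the period.\<close>

lemma proj_nb_window:
  assumes "w < int L" "f \<in> window w x y" "g \<in> window w x y" "proj L (nb i f) = proj L g"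
  shows "nb i f = g"
proof -
  obtain a b u c d v where fg: "nb i f = (a, b, u)" "g = (c, d, v)" by (cases "nb i f"; cases g)
  have "L > 0" using assms by (auto simp: window_def)
  then have "a mod int L = c mod int L \<and> b mod int L = d mod int L \<and> u = v"
    using assms(4) by (simp only: fg proj_eq_iff)
  moreover have "\<bar>a - fst f\<bar> \<le> 1" "\<bar>b - fst (snd f)\<bar> \<le> 1"
    using fg(1) by (cases f, auto split: if_splits)+
  ultimately show ?thesis using assms(1-3) unfolding fg
    by (auto intro!: mod_eq_near [of _ "int L"] simp: window_def)
qed

lemma per_proj:
  assumes "w < int L" "T \<subseteq> window w x y" "L > 0"
  shows "per (tnb L) (proj L ` T) = per nb T" "card (proj L ` T) = card T"
proof -
  have inj: "inj_on (proj L) T"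
    using inj_on_proj_window [OF assms(1)] assms(2) by (rule inj_on_subset)
  show "card (proj L ` T) = card T" using inj by (rule card_image)
  have "{z \<in> proj L ` T. tnb L i z \<notin> proj L ` T} = proj L ` {f \<in> T. nb i f \<notin> T}" for i
  proof (intro equalityI subsetI)
    fix z assume "z \<in> proj L ` {f \<in> T. nb i f \<notin> T}"
    then obtain f where f: "z = proj L f" "f \<in> T" "nb i f \<notin> T" by blast
    have "proj L (nb i f) \<noteq> proj L g" if "g \<in> T" for g
      using proj_nb_window [OF assms(1), of f x y g i] f that assms(2) by blast
    then show "z \<in> {z \<in> proj L ` T. tnb L i z \<notin> proj L ` T}"
      using f assms(3) by (auto simp: tnb_proj simp del: proj.simps nb.simps)
  next
    fix z assume "z \<in> {z \<in> proj L ` T. tnb L i z \<notin> proj L ` T}"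
    then show "z \<in> proj L ` {f \<in> T. nb i f \<notin> T}"
      using assms(3) by (auto simp: tnb_proj simp del: proj.simps nb.simps)
  qed
  moreover have "card (proj L ` {f \<in> T. nb i f \<notin> T}) = card {f \<in> T. nb i f \<notin> T}" for i
    by (rule card_image, rule inj_on_subset [OF inj]) auto
  ultimately show "per (tnb L) (proj L ` T) = per nb T" by (simp add: per_def)
qed

text \<open>A strip of the torus is an orbit of \<open>r\<close>. Each strip that is neither disjoint from
  \<open>S\<close> nor contained in \<open>S\<close> is left by \<open>r\<close> and by its inverse.\<close>
lemma per_ge_cyclic_strips:
  fixes L :: nat and S :: "site set" and k :: "site \<Rightarrow> nat"
  defines "r \<equiv> \<lambda>p q x. tnb L (if snd (snd x) then p else q) x"
  assumes L: "L > 0" and S: "S \<subseteq> Lam L" and p: "p < 3" and q: "q < 3" "p \<noteq> q"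
    and k: "\<And>x. x \<in> Lam L \<Longrightarrow> k (r p q x) = k x"
    and orbit: "\<And>X x y. X \<subseteq> Lam L \<Longrightarrow> (\<And>z. z \<in> X \<Longrightarrow> r p q z \<in> X) \<Longrightarrow>
        x \<in> X \<Longrightarrow> y \<in> Lam L \<Longrightarrow> k y = k x \<Longrightarrow> y \<in> X"
    and size: "\<And>b. b < L \<Longrightarrow> card {x \<in> Lam L. k x = b} = 2 * L"
    and hit: "\<And>b. b < L \<Longrightarrow> \<exists>x\<in>S. k x = b"
  shows "2 * L^2 \<le> L * per (tnb L) S + card S"
proof -
  let ?line = "\<lambda>b. {x \<in> Lam L. k x = b}"
  have fin: "finite S" using S finite_Lam by (rule finite_subset)
  have inv: "r q p (r p q x) = x" "r p q (r q p x) = x" if "x \<in> Lam L" for x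
    using that L by (auto simp: r_def)
  have split: "card S = card {x \<in> S. m x \<in> S} + card {x \<in> S. m x \<notin> S}" for m
    using card_Int_Diff [OF fin, of "{x. m x \<in> S}"] by (simp add: Int_def set_diff_eq)
  \<comment> \<open>Since \<open>r q p\<close> inverts \<open>r p q\<close>, both leave
    \<open>S\<close> equally often. This yields two boundary edges for each strip that is
    cut.\<close>
  have "bij_betw (r p q) {x \<in> S. r p q x \<in> S} {x \<in> S. r q p x \<in> S}"
    by (rule bij_betw_byWitness [where f' = "r q p"]) (use inv S in auto)
  then have "card {x \<in> S. r p q x \<in> S} = card {x \<in> S. r q p x \<in> S}"
    by (rule bij_betw_same_card)
  then have eq: "card {x \<in> S. r p q x \<notin> S} = card {x \<in> S. r q p x \<notin> S}"
    using split [of "r p q"] split [of "r q p"] by simp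
  have "card {x \<in> S. tnb L i x \<notin> S}
      = card {x \<in> S. snd (snd x) \<and> tnb L i x \<notin> S} + card {x \<in> S. \<not> snd (snd x) \<and> tnb L i x \<notin> S}" for i
  proof -
    have "{x \<in> S. tnb L i x \<notin> S}
        = {x \<in> S. snd (snd x) \<and> tnb L i x \<notin> S} \<union> {x \<in> S. \<not> snd (snd x) \<and> tnb L i x \<notin> S}" by auto
    then show ?thesis using fin by (simp only:) (intro card_Un_disjoint, auto)
  qed
  moreover have "card {x \<in> S. r i j x \<notin> S}
      = card {x \<in> S. snd (snd x) \<and> tnb L i x \<notin> S} + card {x \<in> S. \<not> snd (snd x) \<and> tnb L j x \<notin> S}" for i j
  proof -
    have "{x \<in> S. r i j x \<notin> S}
        = {x \<in> S. snd (snd x) \<and> tnb L i x \<notin> S} \<union> {x \<in> S. \<not> snd (snd x) \<and> tnb L j x \<notin> S}"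
      by (auto simp: r_def split: if_splits)
    then show ?thesis using fin by (simp only:) (intro card_Un_disjoint, auto)
  qed
  ultimately have "2 * card {x \<in> S. r p q x \<notin> S}
      = card {x \<in> S. tnb L p x \<notin> S} + card {x \<in> S. tnb L q x \<notin> S}"
    using eq by simp
  also have "\<dots> = (\<Sum>i\<in>{p, q}. card {x \<in> S. tnb L i x \<notin> S})" using q by simp
  also have "\<dots> \<le> per (tnb L) S" unfolding per_def using p q by (intro sum_mono2) auto
  finally have per: "2 * card {x \<in> S. r p q x \<notin> S} \<le> per (tnb L) S" .
  let ?F = "{b. b < L \<and> ?line b \<subseteq> S}" and ?N = "{b. b < L \<and> \<not> ?line b \<subseteq> S}"
  have "?N \<subseteq> k ` {x \<in> S. r p q x \<notin> S}"
  proof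
    fix b assume b: "b \<in> ?N"
    then obtain y where y: "y \<in> Lam L" "k y = b" "y \<notin> S" by auto
    obtain x where x: "x \<in> S" "k x = b" using hit b by blast
    have "\<exists>z\<in>S \<inter> ?line b. r p q z \<notin> S \<inter> ?line b"
      using orbit [of "S \<inter> ?line b" x y] x y S by auto
    then obtain z where "z \<in> S" "z \<in> Lam L" "k z = b" "r p q z \<notin> S \<inter> ?line b" by auto
    moreover have "r p q z \<in> Lam L" using L by (simp add: r_def)
    ultimately show "b \<in> k ` {x \<in> S. r p q x \<notin> S}" using k by auto
  qed
  then have N: "card ?N \<le> card {x \<in> S. r p q x \<notin> S}"
    using fin by (intro surj_card_le) auto
  have "card {..<L} = card (?F \<union> ?N)" by (rule arg_cong [where f = card]) auto
  also have "\<dots> = card ?F + card ?N" by (intro card_Un_disjoint) auto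
  finally have FN: "L = card ?F + card ?N" by simp
  have "card ?F * (2 * L) = (\<Sum>b\<in>?F. card (?line b))" using size by simp
  also have "\<dots> = card (\<Union>b\<in>?F. ?line b)" by (rule card_UN_disjoint [symmetric]) auto
  also have "\<dots> \<le> card S" using fin by (intro card_mono) auto
  finally have F: "card ?F * (2 * L) \<le> card S" .
  have "2 * l^2 = l * (2 * n) + m * (2 * l)" if "l = m + n" for l m n :: nat
    unfolding that by (simp add: power2_eq_square algebra_simps)
  then have "2 * L^2 = L * (2 * card ?N) + card ?F * (2 * L)" using FN .
  also have "\<dots> \<le> L * per (tnb L) S + card S"
    using per N F by (intro add_mono mult_le_mono2) auto
  finally show ?thesis .
qed

lemma mod_orbit:
  fixes a c L :: nat
  assumes "\<And>a. a < L \<Longrightarrow> P a \<Longrightarrow> P ((a + 1) mod L)" "P a" "a < L" "c < L"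
  shows "P c"
proof -
  have "P ((a + n) mod L)" for n
  proof (induction n)
    case (Suc n)
    then show ?case using assms(1) [of "(a + n) mod L"] assms(3) by (simp add: mod_simps)
  qed (use assms in simp)
  from this [of "L - a + c"] show ?thesis using assms by simp
qed

lemma torus_isoperimetry:
  assumes L: "L \<ge> 2" and S: "S \<subseteq> Lam L"
  shows "2 * L^2 \<le> L * per (tnb L) S + card S \<or> 6 * card S \<le> (per (tnb L) S)^2"
proof -
  consider "\<And>b. b < L \<Longrightarrow> \<exists>x\<in>S. fst (snd x) = b" | "\<And>a. a < L \<Longrightarrow> \<exists>x\<in>S. fst x = a"
    | a b where "a < L" "b < L" "\<And>x. x \<in> S \<Longrightarrow> fst x \<noteq> a" "\<And>x. x \<in> S \<Longrightarrow> fst (snd x) \<noteq> b" by metis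
  then show ?thesis
  proof cases
    case 1
    have "2 * L^2 \<le> L * per (tnb L) S + card S"
    proof (rule per_ge_cyclic_strips [where p = 0 and q = 1 and k = "\<lambda>x. fst (snd x)"])
      fix x assume "x \<in> Lam L"
      then show "fst (snd (tnb L (if snd (snd x) then 0 else 1) x)) = fst (snd x)"
        by (cases x) (auto simp: Lam_def tnb_cases [OF L] simp del: One_nat_def)
    next
      fix X x y assume X: "X \<subseteq> Lam L" "x \<in> X" "y \<in> Lam L" "fst (snd y) = fst (snd x)"
        and r: "\<And>z. z \<in> X \<Longrightarrow> tnb L (if snd (snd z) then 0 else 1) z \<in> X"
      obtain a b u c v where xy: "x = (a, b, u)" "y = (c, b, v)" using X by (cases x; cases y) auto
      have lt: "a < L" "b < L" "c < L" using X by (auto simp: xy Lam_def)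
      have T: "(a, b, True) \<in> X \<Longrightarrow> (a, b, False) \<in> X" if "a < L" for a
        using r [of "(a, b, True)"] that lt by (simp add: tnb_cases [OF L] del: One_nat_def)
      have F: "(a, b, False) \<in> X \<Longrightarrow> ((a + 1) mod L, b, True) \<in> X" if "a < L" for a
        using r [of "(a, b, False)"] that lt by (simp add: tnb_cases [OF L] del: One_nat_def)
      have "(a, b, False) \<in> X" using T [of a] X lt by (cases u) (auto simp: xy)
      then have "(c, b, False) \<in> X" "((a + 1) mod L, b, True) \<in> X"
        using mod_orbit [of L "\<lambda>a. (a, b, False) \<in> X" a c] T F lt by auto
      then have "(c, b, False) \<in> X" "(c, b, True) \<in> X"
        using mod_orbit [of L "\<lambda>a. (a, b, True) \<in> X" "(a + 1) mod L" c] T F lt by auto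
      then show "y \<in> X" by (cases v) (auto simp: xy)
    next
      fix b assume "b < L"
      then have "{x \<in> Lam L. fst (snd x) = b} = {0..<L} \<times> {b} \<times> UNIV" by (auto simp: Lam_def)
      then show "card {x \<in> Lam L. fst (snd x) = b} = 2 * L" by (simp add: card_cartesian_product)
    qed (use assms 1 in auto)
    then show ?thesis ..
  next
    case 2
    have "2 * L^2 \<le> L * per (tnb L) S + card S"
    proof (rule per_ge_cyclic_strips [where p = 0 and q = 2 and k = "\<lambda>x. fst x"])
      fix x assume "x \<in> Lam L"
      then show "fst (tnb L (if snd (snd x) then 0 else 2) x) = fst x"
        by (cases x) (auto simp: Lam_def tnb_cases [OF L] simp del: One_nat_def)
    next
      fix X x y assume X: "X \<subseteq> Lam L" "x \<in> X" "y \<in> Lam L" "fst y = fst x"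
        and r: "\<And>z. z \<in> X \<Longrightarrow> tnb L (if snd (snd z) then 0 else 2) z \<in> X"
      obtain a b u c v where xy: "x = (b, a, u)" "y = (b, c, v)" using X by (cases x; cases y) auto
      have lt: "a < L" "b < L" "c < L" using X by (auto simp: xy Lam_def)
      have T: "(b, a, True) \<in> X \<Longrightarrow> (b, a, False) \<in> X" if "a < L" for a
        using r [of "(b, a, True)"] that lt by (simp add: tnb_cases [OF L] del: One_nat_def)
      have F: "(b, a, False) \<in> X \<Longrightarrow> (b, (a + 1) mod L, True) \<in> X" if "a < L" for a
        using r [of "(b, a, False)"] that lt by (simp add: tnb_cases [OF L] del: One_nat_def)
      have "(b, a, False) \<in> X" using T [of a] X lt by (cases u) (auto simp: xy)
      then have "(b, c, False) \<in> X" "(b, (a + 1) mod L, True) \<in> X"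
        using mod_orbit [of L "\<lambda>a. (b, a, False) \<in> X" a c] T F lt by auto
      then have "(b, c, False) \<in> X" "(b, c, True) \<in> X"
        using mod_orbit [of L "\<lambda>a. (b, a, True) \<in> X" "(a + 1) mod L" c] T F lt by auto
      then show "y \<in> X" by (cases v) (auto simp: xy)
    next
      fix b assume "b < L"
      then have "{x \<in> Lam L. fst x = b} = {b} \<times> {0..<L} \<times> UNIV" by (auto simp: Lam_def)
      then show "card {x \<in> Lam L. fst x = b} = 2 * L" by (simp add: card_cartesian_product)
    qed (use assms 2 in auto)
    then show ?thesis ..
  next
    case 3
    let ?W = "window (int L - 1) (int a + 1) (int b + 1)"
    \<comment> \<open>The torus is cut along the avoided column \<open>a\<close> and row
      \<open>b\<close>. The window starts just after them, so coordinates below \<open>a\<close> or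
      \<open>b\<close> are represented one period higher.\<close>
    let ?T = "{f \<in> ?W. proj L f \<in> S}"
    have "S \<subseteq> proj L ` ?T"
    proof
      fix x assume x: "x \<in> S"
      obtain c d u where x': "x = (c, d, u)" by (cases x)
      have lt: "c < L" "d < L" using x S by (auto simp: x' Lam_def)
      have ne: "c \<noteq> a" "d \<noteq> b" using 3(3) [OF x] 3(4) [OF x] by (simp_all add: x')
      let ?f = "(if a < c then int c else int c + int L, if b < d then int d else int d + int L, u)"
      have "proj L ?f = x" using lt by (auto simp: x')
      moreover have "?f \<in> ?W" using lt ne 3(1,2) by (auto simp: window_def)
      ultimately have "?f \<in> ?T" "x = proj L ?f" using x by simp_all
      then show "x \<in> proj L ` ?T" by (rule image_eqI [rotated])
    qed
    then have ST: "S = proj L ` ?T" by auto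
    have "per (tnb L) (proj L ` ?T) = per nb ?T" "card (proj L ` ?T) = card ?T"
      using L by (auto intro!: per_proj [of "int L - 1" L ?T "int a + 1" "int b + 1"])
    moreover have "6 * card ?T \<le> (per nb ?T)^2" by (rule planar_isoperimetry) simp
    ultimately show ?thesis using ST by simp
  qed
qed

subsection \<open>Configurations and paths\<close>

definition cfg :: "nat \<Rightarrow> site set \<Rightarrow> config" where
  "cfg L S = restrict (\<lambda>x. if x \<in> S then 1 else -1) (Lam L)"

definition energy :: "real \<Rightarrow> real \<Rightarrow> nat \<Rightarrow> site set \<Rightarrow> real" where
  "energy J h L S = J * real (per (tnb L) S) - h * real (card S)"

lemma cfg_empty: "cfg L {} = all_minus L"
  by (simp add: cfg_def all_minus_def)

lemma cfg_Lam: "cfg L (Lam L) = all_plus L"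
  by (auto simp: cfg_def all_plus_def)

lemma cfg_in_Conf [simp]: "cfg L S \<in> Conf L"
  by (auto simp: cfg_def Conf_def)

lemma Conf_cfg:
  assumes "\<sigma> \<in> Conf L"
  obtains S where "S \<subseteq> Lam L" "\<sigma> = cfg L S"
proof
  show "{x \<in> Lam L. \<sigma> x = 1} \<subseteq> Lam L" by auto
  show "\<sigma> = cfg L {x \<in> Lam L. \<sigma> x = 1}"
    using assms by (fastforce simp: cfg_def Conf_def PiE_iff extensional_def restrict_def)
qed

lemma cfg_eq_iff:
  assumes "S \<subseteq> Lam L" "T \<subseteq> Lam L"
  shows "cfg L S = cfg L T \<longleftrightarrow> S = T"
proof
  have "S = {x \<in> Lam L. cfg L S x = 1}" "T = {x \<in> Lam L. cfg L T x = 1}"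
    using assms by (auto simp: cfg_def split: if_splits)
  then show "cfg L S = cfg L T \<Longrightarrow> S = T" by metis
qed simp

lemma flip_cfg:
  assumes "x \<in> Lam L"
  shows "flip (cfg L S) x = cfg L (if x \<in> S then S - {x} else insert x S)"
  using assms by (auto simp: flip_def cfg_def restrict_def fun_eq_iff)

lemma finite_Conf [simp]: "finite (Conf L)"
  by (simp add: Conf_def finite_PiE)

text \<open>A boundary edge is met from both of its ends and each time lowers a product of spins
  from 1 to -1, whence the coefficient 4. Comparison with the empty set cancels the
  constants.\<close>

lemma Ham_cfg:
  assumes L: "L \<ge> 2" and S: "S \<subseteq> Lam L"
  shows "Ham J h L (cfg L S) = Ham J h L (all_minus L) + energy J h L S"
proof -
  have bond: "(\<Sum>x\<in>Lam L. real_of_int (cfg L S x * cfg L S (tnb L i x)))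
      = real (card (Lam L)) - 4 * real (card {x \<in> S. tnb L i x \<notin> S})"
    if S: "S \<subseteq> Lam L" for i S
  proof -
    let ?m = "tnb L i"
    have "bij_betw ?m {x \<in> S. ?m x \<notin> S} {x \<in> Lam L. ?m x \<in> S \<and> x \<notin> S}"
      by (rule bij_betw_byWitness [where f' = ?m]) (use S L in auto)
    then have eq: "card {x \<in> Lam L. ?m x \<in> S \<and> x \<notin> S} = card {x \<in> S. ?m x \<notin> S}"
      by (simp add: bij_betw_same_card)
    have eq': "{x \<in> Lam L. x \<in> S \<and> ?m x \<notin> S} = {x \<in> S. ?m x \<notin> S}" using S by auto
    have "(\<Sum>x\<in>Lam L. real_of_int (cfg L S x * cfg L S (?m x)))
        = (\<Sum>x\<in>Lam L. 1 - 2 * of_bool (x \<in> S \<and> ?m x \<notin> S) - 2 * of_bool (?m x \<in> S \<and> x \<notin> S))"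
      by (rule sum.cong) (use L in \<open>auto simp: cfg_def\<close>)
    also have "\<dots> = real (card (Lam L)) - 2 * real (card {x \<in> Lam L. x \<in> S \<and> ?m x \<notin> S})
        - 2 * real (card {x \<in> Lam L. ?m x \<in> S \<and> x \<notin> S})"
      by (simp only: sum_subtractf sum_distrib_left [symmetric] sum_of_bool_eq finite_Lam Int_def
          mem_Collect_eq sum_constant)
    finally show ?thesis by (simp add: eq eq')
  qed
  have "(\<Sum>x\<in>Lam L. \<Sum>j\<in>{j \<in> Lam L. nbr L x j}. real_of_int (cfg L S x * cfg L S j))
      = 3 * real (card (Lam L)) - 4 * real (per (tnb L) S)" if S: "S \<subseteq> Lam L" for S
  proof -
    have "(\<Sum>x\<in>Lam L. \<Sum>j\<in>{j \<in> Lam L. nbr L x j}. real_of_int (cfg L S x * cfg L S j))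
        = (\<Sum>x\<in>Lam L. \<Sum>i<3. real_of_int (cfg L S x * cfg L S (tnb L i x)))"
      by (rule sum.cong [OF refl]) (rule sum_nbr [OF L])
    also have "\<dots> = (\<Sum>i<3. \<Sum>x\<in>Lam L. real_of_int (cfg L S x * cfg L S (tnb L i x)))"
      by (rule sum.swap)
    also have "\<dots> = (\<Sum>i<3. real (card (Lam L)) - 4 * real (card {x \<in> S. tnb L i x \<notin> S}))"
      using bond [OF S] by simp
    finally show ?thesis by (simp add: per_def sum3)
  qed
  moreover have "(\<Sum>x\<in>Lam L. real_of_int (cfg L S x)) = 2 * real (card S) - real (card (Lam L))"
    if S: "S \<subseteq> Lam L" for S
  proof -
    have "(\<Sum>x\<in>Lam L. real_of_int (cfg L S x)) = (\<Sum>x\<in>Lam L. 2 * of_bool (x \<in> S) - 1)"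
      by (rule sum.cong) (auto simp: cfg_def)
    also have "\<dots> = 2 * real (card (Lam L \<inter> S)) - real (card (Lam L))"
      by (simp add: sum_subtractf sum_distrib_left [symmetric] Int_def)
    also have "Lam L \<inter> S = S" using S by auto
    finally show ?thesis .
  qed
  ultimately have "Ham J h L (cfg L S) = - (J / 4) * (3 * real (card (Lam L)) - 4 * real (per (tnb L) S))
      - (h / 2) * (2 * real (card S) - real (card (Lam L)))" if "S \<subseteq> Lam L" for S
    using that by (simp add: Ham_def)
  from this [OF S] this [of "{}"] show ?thesis
    by (simp add: cfg_empty energy_def field_simps)
qed

lemma energy_submodular:
  assumes "J \<ge> 0" "finite A" "finite B"
  shows "energy J h L (A \<union> B) + energy J h L (A \<inter> B) \<le> energy J h L A + energy J h L B"
proof -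
  have "J * real (per (tnb L) (A \<union> B) + per (tnb L) (A \<inter> B)) \<le> J * real (per (tnb L) A + per (tnb L) B)"
    using assms by (intro mult_left_mono of_nat_mono per_submodular) auto
  moreover have "real (card (A \<union> B)) + real (card (A \<inter> B)) = real (card A) + real (card B)"
    using card_Un_Int [OF assms(2,3)] by simp
  then have "h * real (card (A \<union> B)) + h * real (card (A \<inter> B)) = h * real (card A) + h * real (card B)"
    by (metis distrib_left)
  ultimately show ?thesis by (simp add: energy_def algebra_simps)
qed

lemma path_snoc:
  assumes "p \<in> Paths L \<sigma> \<eta>" "x \<in> Lam L" "flip \<eta> x \<in> Conf L"
  shows "p @ [flip \<eta> x] \<in> Paths L \<sigma> (flip \<eta> x)"
proof -
  have p: "p \<noteq> []" "last p = \<eta>" using assms by (auto simp: Paths_def is_path_def)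
  have "\<exists>y\<in>Lam L. (p @ [flip \<eta> x]) ! Suc k = flip ((p @ [flip \<eta> x]) ! k) y"
    if k: "Suc k < Suc (length p)" for k
  proof (cases "Suc k < length p")
    case True
    then show ?thesis using assms(1) by (simp add: Paths_def is_path_def nth_append)
  next
    case False
    then have "k = length p - 1" using k by simp
    then show ?thesis using p assms(2) by (auto simp: nth_append last_conv_nth)
  qed
  then show ?thesis using assms by (auto simp: Paths_def is_path_def)
qed

text \<open>Members of \<open>ys\<close> that are already present cause no flip, so the path may be
  shorter than \<open>ys\<close> and only an inclusion is claimed for its configurations.\<close>

lemma path_add:
  assumes "S \<subseteq> Lam L" "set ys \<subseteq> Lam L"
  obtains p where "p \<in> Paths L (cfg L S) (cfg L (S \<union> set ys))"
    "set p \<subseteq> (\<lambda>k. cfg L (S \<union> set (take k ys))) ` {..length ys}"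
  using assms(2)
proof (induction ys arbitrary: thesis rule: rev_induct)
  case Nil
  have "[cfg L S] \<in> Paths L (cfg L S) (cfg L (S \<union> set []))"
    by (simp add: Paths_def is_path_def)
  then show ?case by (rule Nil(1)) auto
next
  case (snoc y ys)
  then obtain p where p: "p \<in> Paths L (cfg L S) (cfg L (S \<union> set ys))"
    "set p \<subseteq> (\<lambda>k. cfg L (S \<union> set (take k ys))) ` {..length ys}" by auto
  have sub: "(\<lambda>k. cfg L (S \<union> set (take k ys))) ` {..length ys}
      \<subseteq> (\<lambda>k. cfg L (S \<union> set (take k (ys @ [y])))) ` {..length (ys @ [y])}"
  proof
    fix \<zeta> assume "\<zeta> \<in> (\<lambda>k. cfg L (S \<union> set (take k ys))) ` {..length ys}"
    then obtain k where "k \<le> length ys" "\<zeta> = cfg L (S \<union> set (take k (ys @ [y])))" by auto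
    then show "\<zeta> \<in> (\<lambda>k. cfg L (S \<union> set (take k (ys @ [y])))) ` {..length (ys @ [y])}"
      by (intro image_eqI [where x = k]) auto
  qed
  show ?case
  proof (cases "y \<in> S \<union> set ys")
    case True
    then have "S \<union> set (ys @ [y]) = S \<union> set ys" by auto
    then show ?thesis using p sub snoc.prems(1) [of p] by auto
  next
    case False
    have y: "y \<in> Lam L" using snoc.prems by auto
    let ?\<eta> = "cfg L (S \<union> set (ys @ [y]))"
    have f: "flip (cfg L (S \<union> set ys)) y = ?\<eta>" using False y by (simp add: flip_cfg)
    have "p @ [?\<eta>] \<in> Paths L (cfg L S) ?\<eta>"
      using path_snoc [OF p(1) y] unfolding f by simp
    moreover have "set (p @ [?\<eta>]) \<subseteq> (\<lambda>k. cfg L (S \<union> set (take k (ys @ [y])))) ` {..length (ys @ [y])}"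
      using p(2) sub by (auto intro: image_eqI [where x = "length (ys @ [y])"])
    ultimately show ?thesis using snoc.prems(1) by blast
  qed
qed

text \<open>A discrete intermediate value argument: a flip changes the number of plus spins by
  one.\<close>

lemma path_card_crosses:
  assumes "is_path L p" "hd p = cfg L S" "last p = cfg L T" "S \<subseteq> Lam L" "T \<subseteq> Lam L"
    and "card S \<le> n" "n \<le> card T"
  shows "\<exists>U. U \<subseteq> Lam L \<and> card U = n \<and> cfg L U \<in> set p"
  using assms
proof (induction p arbitrary: S)
  case (Cons a p)
  show ?case
  proof (cases "p = [] \<or> card S = n")
    case True
    then show ?thesis using Cons.prems cfg_eq_iff [of S L T] by auto
  next
    case False
    have "\<exists>x\<in>Lam L. (a # p) ! Suc 0 = flip ((a # p) ! 0) x"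
      using Cons.prems(1) False unfolding is_path_def by (metis length_Cons length_greater_0_conv Suc_less_eq)
    then obtain x where x: "x \<in> Lam L" "p ! 0 = flip (cfg L S) x" using Cons.prems by auto
    let ?S = "if x \<in> S then S - {x} else insert x S"
    have fin: "finite S" using Cons.prems finite_Lam by (meson finite_subset)
    have hd: "hd p = cfg L ?S" using x False by (simp add: hd_conv_nth flip_cfg)
    have "is_path L p" using Cons.prems(1) False unfolding is_path_def
      by (metis Suc_less_eq length_Cons list.set_intros(2) nth_Cons_Suc subset_code(1))
    moreover have "card ?S \<le> n" using fin False Cons.prems by (auto simp: card_insert_if)
    ultimately have "\<exists>U. U \<subseteq> Lam L \<and> card U = n \<and> cfg L U \<in> set p"
      using Cons.prems False x hd by (intro Cons.IH [of ?S]) auto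
    then show ?thesis by auto
  qed
qed (simp add: is_path_def)

section \<open>Communication heights as minima over paths\<close>

text \<open>Paths may be arbitrarily long, but their maxima are values of \<open>Ham\<close> on the
  finite set \<open>Conf L\<close>. This makes the \<open>Min\<close> in \<open>Phi\<close>
  meaningful.\<close>

lemma finite_path_maxima: "finite {Max (Ham J h L ` set p) | p. p \<in> Paths L \<sigma> \<eta>}"
proof (rule finite_subset)
  show "{Max (Ham J h L ` set p) | p. p \<in> Paths L \<sigma> \<eta>} \<subseteq> Ham J h L ` Conf L"
  proof
    fix v assume "v \<in> {Max (Ham J h L ` set p) | p. p \<in> Paths L \<sigma> \<eta>}"
    then obtain p where p: "p \<in> Paths L \<sigma> \<eta>" "v = Max (Ham J h L ` set p)" by auto
    then have "v \<in> Ham J h L ` set p" by (auto intro!: Max_in simp: Paths_def is_path_def)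
    moreover have "Ham J h L ` set p \<subseteq> Ham J h L ` Conf L"
      using p by (intro image_mono) (simp add: Paths_def is_path_def)
    ultimately show "v \<in> Ham J h L ` Conf L" by (rule rev_subsetD)
  qed
qed simp

lemma Phi_le:
  assumes "p \<in> Paths L \<sigma> \<eta>"
  shows "Phi J h L \<sigma> \<eta> \<le> Max (Ham J h L ` set p)"
  unfolding Phi_def by (rule Min_le [OF finite_path_maxima]) (use assms in auto)

lemma Phi_ge:
  assumes "Paths L \<sigma> \<eta> \<noteq> {}" "\<And>p. p \<in> Paths L \<sigma> \<eta> \<Longrightarrow> \<exists>\<zeta>\<in>set p. E \<le> Ham J h L \<zeta>"
  shows "E \<le> Phi J h L \<sigma> \<eta>"
  unfolding Phi_def
proof (subst Min_ge_iff [OF finite_path_maxima])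
  show "{Max (Ham J h L ` set p) |p. p \<in> Paths L \<sigma> \<eta>} \<noteq> {}" using assms(1) by auto
  show "\<forall>v\<in>{Max (Ham J h L ` set p) |p. p \<in> Paths L \<sigma> \<eta>}. E \<le> v"
  proof
    fix v assume "v \<in> {Max (Ham J h L ` set p) |p. p \<in> Paths L \<sigma> \<eta>}"
    then obtain p where p: "p \<in> Paths L \<sigma> \<eta>" "v = Max (Ham J h L ` set p)" by auto
    then obtain \<zeta> where "\<zeta> \<in> set p" "E \<le> Ham J h L \<zeta>" using assms(2) by blast
    then show "E \<le> v" unfolding p(2) by (subst Max_ge_iff) auto
  qed
qed

lemma Phi_set_le:
  assumes "\<eta> \<in> B" "B \<subseteq> Conf L"
  shows "Phi_set J h L {\<sigma>} B \<le> Phi J h L \<sigma> \<eta>"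
proof -
  have "finite B" using assms(2) finite_Conf by (rule finite_subset)
  then show ?thesis unfolding Phi_set_def using assms by (intro Min_le) auto
qed

lemma Phi_set_ge:
  assumes "B \<noteq> {}" "B \<subseteq> Conf L" "\<And>\<eta>. \<eta> \<in> B \<Longrightarrow> E \<le> Phi J h L \<sigma> \<eta>"
  shows "E \<le> Phi_set J h L {\<sigma>} B"
proof -
  have "finite B" using assms(2) finite_Conf by (rule finite_subset)
  then show ?thesis unfolding Phi_set_def using assms by (subst Min_ge_iff) auto
qed

subsection \<open>Hexagonal spirals\<close>

text \<open>By isoperimetry and parity, this says that each nonempty prefix has the least perimeter
  possible for its size: \<open>(p - 2)^2 < 6 * k\<close> rules out every smaller value of the right
  parity.\<close>

definition tight :: "face list \<Rightarrow> bool" where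
  "tight xs \<longleftrightarrow> distinct xs \<and>
     (\<forall>k. 0 < k \<and> k \<le> length xs \<longrightarrow> (int (per nb (set (take k xs))) - 2)^2 < 6 * int k)"

lemma nb_neq [simp]: "nb i f \<noteq> f"
  using nb_colour [of i f] by metis

text \<open>Ensures that \<open>p - 2\<close> is positive where its square is to be estimated
  monotonically.\<close>

lemma per_nb_ge_3:
  assumes "finite T" "T \<noteq> {}"
  shows "per nb T \<ge> 3"
proof (rule ccontr)
  assume "\<not> per nb T \<ge> 3"
  then have "(per nb T)^2 \<le> 2^2" by (intro power_mono) auto
  moreover have "card T \<ge> 1" using assms by (simp add: Suc_le_eq card_gt_0_iff)
  ultimately show False using planar_isoperimetry [OF assms(1)] by simp
qed

text \<open>The first face touches \<open>X\<close> and adds 1. After that, linking faces touch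
  their predecessor and add 1, while the others touch both their predecessor and \<open>X\<close>
  and subtract 1.\<close>

lemma per_bar:
  fixes g :: "nat \<Rightarrow> face"
  assumes X: "finite X" and inj: "inj_on g {..<n}" and new: "\<And>t. t < n \<Longrightarrow> g t \<notin> X"
    and chain: "\<And>t. Suc t < n \<Longrightarrow> \<exists>i<3. nb i (g (Suc t)) = g t"
    and contact: "\<And>t. t < n \<Longrightarrow> even t \<Longrightarrow> \<exists>i<3. nb i (g t) \<in> X"
    and t: "t \<le> n"
  shows "per nb (X \<union> g ` {..<t}) \<le> per nb X + (if t = 0 then 0 else if odd t then 1 else 2)"
  using t
proof (induction t)
  case (Suc t)
  let ?A = "X \<union> g ` {..<t}"
  let ?c = "\<lambda>i. (if nb i (g t) \<in> ?A then 1 else 0) :: int"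
  have nonneg: "?c i \<ge> 0" for i by simp
  have notin: "g t \<notin> ?A" using Suc.prems new inj by (force simp: inj_on_def)
  have "X \<union> g ` {..<Suc t} = insert (g t) ?A" by (auto simp: lessThan_Suc)
  then have step: "int (per nb (X \<union> g ` {..<Suc t})) = int (per nb ?A) + 3 - 2 * (\<Sum>i<3. ?c i)"
    using per_insert [of ?A "g t" nb] X notin by simp
  have pred: "\<exists>i<3. nb i (g t) \<in> g ` {..<t}" if t: "t > 0"
  proof -
    obtain s where s: "t = Suc s" using t gr0_conv_Suc by blast
    then obtain i where "i < 3" "nb i (g t) = g s" using chain [of s] Suc.prems by auto
    then show ?thesis using s by auto
  qed
  have one: "(\<Sum>i<3. ?c i) \<ge> 1"
  proof -
    obtain i where "i < 3" "nb i (g t) \<in> ?A"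
      using contact [of t] pred Suc.prems by (cases "t = 0") auto
    then show ?thesis using member_le_sum [of i "{..<3}" ?c] nonneg by auto
  qed
  show ?case
  proof (cases "t > 0 \<and> even t")
    case True
    obtain i where i: "i < 3" "nb i (g t) \<in> X" using contact [of t] True Suc.prems by auto
    obtain j where j: "j < 3" "nb j (g t) \<in> g ` {..<t}" using pred True by auto
    have "i \<noteq> j" using i j new Suc.prems by auto
    then have "2 = (\<Sum>i\<in>{i, j}. ?c i)" using i j by simp
    also have "\<dots> \<le> (\<Sum>i<3. ?c i)" using i j by (intro sum_mono2) auto
    finally show ?thesis using step Suc True by (simp split: if_splits)
  next
    case False
    then show ?thesis using step Suc one by (auto split: if_splits)
  qed
qed simp

text \<open>Along the bar the perimeter is at most \<open>q + 1\<close> or \<open>q + 2\<close>, by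
  the parity of the number of added faces. The bounds are most demanding after one and two faces,
  and these are the two size conditions.\<close>

lemma tight_append_bar:
  fixes g :: "nat \<Rightarrow> face" and q :: int
  assumes xs: "tight xs" "xs \<noteq> []" and q: "int (per nb (set xs)) \<le> q"
    and inj: "inj_on g {..<n}" and new: "\<And>t. t < n \<Longrightarrow> g t \<notin> set xs"
    and chain: "\<And>t. Suc t < n \<Longrightarrow> \<exists>i<3. nb i (g (Suc t)) = g t"
    and contact: "\<And>t. t < n \<Longrightarrow> even t \<Longrightarrow> \<exists>i<3. nb i (g t) \<in> set xs"
    and n: "odd n" and size: "(q - 1)^2 < 6 * (int (length xs) + 1)" "q^2 < 6 * (int (length xs) + 2)"
  shows "tight (xs @ map g [0..<n])" "int (per nb (set (xs @ map g [0..<n]))) \<le> q + 1"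
proof -
  have bar: "int (per nb (set xs \<union> g ` {..<t})) \<le> q + (if t = 0 then 0 else if odd t then 1 else 2)"
    if "t \<le> n" for t
    using per_bar [OF finite_set inj new chain contact that] q by (auto split: if_splits)
  show "int (per nb (set (xs @ map g [0..<n]))) \<le> q + 1"
    using bar [of n] n odd_pos [OF n] by (simp add: atLeast0LessThan)
  show "tight (xs @ map g [0..<n])"
    unfolding tight_def
  proof (intro conjI allI impI)
    show "distinct (xs @ map g [0..<n])"
      using xs inj new by (auto simp: tight_def distinct_map atLeast0LessThan)
  next
    fix k assume k: "0 < k \<and> k \<le> length (xs @ map g [0..<n])"
    let ?p = "int (per nb (set (take k (xs @ map g [0..<n]))))"
    show "(?p - 2)^2 < 6 * int k"
    proof (cases "k \<le> length xs")
      case True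
      then show ?thesis using xs k by (simp add: tight_def)
    next
      case False
      define t where "t = k - length xs"
      have t: "k = length xs + t" "0 < t" "t \<le> n" using False k by (auto simp: t_def)
      have "set (take k (xs @ map g [0..<n])) = set xs \<union> g ` {..<t}"
        using t by (simp add: take_map atLeast0LessThan)
      then have p: "?p \<le> q + (if odd t then 1 else 2)" using bar [of t] t by simp
      have "?p \<ge> 3" using per_nb_ge_3 [of "set (take k (xs @ map g [0..<n]))"] xs k by auto
      then have "(?p - 2)^2 \<le> (q + (if odd t then 1 else 2) - 2)^2"
        using p by (intro power_mono) auto
      also have "\<dots> < 6 * int k"
      proof (cases "odd t")
        case True
        then show ?thesis using size(1) t by (auto simp: algebra_simps)
      next
        case False
        then have "t \<ge> 2" using t by presburger
        then show ?thesis using size(2) t False by auto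
      qed
      finally show ?thesis .
    qed
  qed
qed

text \<open>With all three ranges from \<open>-R\<close> to \<open>R - 1\<close> this is the regular
  hexagon of side \<open>R\<close> around the lattice vertex \<open>(0, 0)\<close>.\<close>

definition hexagon :: "int \<Rightarrow> int \<Rightarrow> int \<Rightarrow> int \<Rightarrow> int \<Rightarrow> int \<Rightarrow> face set" where
  "hexagon a0 a1 b0 b1 d0 d1 = {f. a0 \<le> fst f \<and> fst f \<le> a1 \<and> b0 \<le> fst (snd f) \<and> fst (snd f) \<le> b1
     \<and> d0 \<le> diag f \<and> diag f \<le> d1}"

text \<open>The first face is fixed because the embedding into the torus will send it to a
  prescribed site.\<close>

definition spiral :: "int \<Rightarrow> int \<Rightarrow> face set \<Rightarrow> face list \<Rightarrow> bool" where
  "spiral q K X xs \<longleftrightarrow> tight xs \<and> xs \<noteq> [] \<and> hd xs = (0, 0, True) \<and> set xs = X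
     \<and> int (per nb X) \<le> q \<and> int (length xs) = K"

text \<open>A bar glued to a side of \<open>X\<close> alternates between faces \<open>c s\<close> sharing an edge
  with \<open>X\<close> and faces \<open>l s\<close> linking \<open>c s\<close> to \<open>c (s + 1)\<close>.\<close>
lemma spiral_bar:
  fixes c l :: "int \<Rightarrow> face"
  assumes xs: "spiral q K X xs" and m: "m \<ge> 0" and XY: "X \<subseteq> Y"
    and c: "\<And>s. 0 \<le> s \<Longrightarrow> s \<le> m \<Longrightarrow> c s \<in> Y \<and> c s \<notin> X \<and> w (c s) = s \<and> snd (snd (c s)) = u \<and> (\<exists>i<3. nb i (c s) \<in> X)"
    and l: "\<And>s. 0 \<le> s \<Longrightarrow> s < m \<Longrightarrow> l s \<in> Y \<and> l s \<notin> X \<and> w (l s) = s \<and> snd (snd (l s)) \<noteq> u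
        \<and> (\<exists>i<3. nb i (l s) = c s) \<and> (\<exists>i<3. nb i (c (s + 1)) = l s)"
    and w: "\<And>f. f \<in> Y \<Longrightarrow> f \<notin> X \<Longrightarrow> 0 \<le> w f \<and>
        (if snd (snd f) = u then w f \<le> m \<and> c (w f) = f else w f < m \<and> l (w f) = f)"
    and size: "(q - 1)^2 < 6 * (K + 1)" "q^2 < 6 * (K + 2)"
  shows "\<exists>xs. spiral (q + 1) (K + 2 * m + 1) Y xs"
proof -
  define g where "g t = (if even t then c (int t div 2) else l (int t div 2))" for t :: nat
  define n where "n = nat (2 * m + 1)"
  have n: "odd n" "int n = 2 * m + 1" unfolding n_def using m by (auto simp: even_nat_iff)
  have even: "\<exists>s. int t = 2 * s \<and> 0 \<le> s \<and> s \<le> m \<and> g t = c s" if "t < n" "even t" for t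
    using that n by (auto simp: g_def intro!: exI [of _ "int t div 2"])
  have odd: "\<exists>s. int t = 2 * s + 1 \<and> 0 \<le> s \<and> s < m \<and> g t = l s" if "t < n" "odd t" for t
    using that n by (auto simp: g_def intro!: exI [of _ "int t div 2"]) presburger+
  \<comment> \<open>\<open>w\<close> and the orientation determine the position in the bar, so
    \<open>g\<close> is injective.\<close>
  have new: "g t \<in> Y \<and> g t \<notin> X \<and> (2 * w (g t) + (if snd (snd (g t)) = u then 0 else 1)) = int t"
    if t: "t < n" for t
  proof (cases "even t")
    case True
    then obtain s where "int t = 2 * s" "0 \<le> s" "s \<le> m" "g t = c s" using even [OF t] by auto
    then show ?thesis using c [of s] by simp
  next
    case False
    then obtain s where "int t = 2 * s + 1" "0 \<le> s" "s < m" "g t = l s" using odd [OF t] by auto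
    then show ?thesis using l [of s] by simp
  qed
  have inj: "inj_on g {..<n}"
    using new by (intro inj_onI) (metis lessThan_iff of_nat_eq_iff)
  have chain: "\<exists>i<3. nb i (g (Suc t)) = g t" if t: "Suc t < n" for t
  proof (cases "even t")
    case True
    then obtain s where s: "int t = 2 * s" "0 \<le> s" "g t = c s" using even [of t] t by auto
    obtain s' where s': "int (Suc t) = 2 * s' + 1" "s' < m" "g (Suc t) = l s'" using odd [of "Suc t"] t True by auto
    have "s' = s" using s s' by simp
    then show ?thesis using l [of s] s(2,3) s'(2,3) by simp
  next
    case False
    then obtain s where s: "int t = 2 * s + 1" "0 \<le> s" "s < m" "g t = l s" using odd [of t] t by auto
    obtain s' where s': "int (Suc t) = 2 * s'" "g (Suc t) = c s'" using even [of "Suc t"] t False by auto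
    have "s' = s + 1" using s s' by simp
    then show ?thesis using l [of s] s(2-4) s'(2) by simp
  qed
  have contact: "\<exists>i<3. nb i (g t) \<in> X" if "t < n" "even t" for t
    using even [OF that] c by metis
  have Y: "Y = X \<union> g ` {..<n}"
  proof (intro equalityI subsetI)
    fix f assume f: "f \<in> Y"
    show "f \<in> X \<union> g ` {..<n}"
    proof (cases "f \<in> X")
      case False
      define t where "t = nat (2 * w f + (if snd (snd f) = u then 0 else 1))"
      have "t < n" "g t = f"
        using w [OF f False] n by (auto simp: t_def g_def n_def nat_less_iff even_nat_iff split: if_splits)
      then show ?thesis by auto
    qed simp
  qed (use new XY in auto)
  have X: "tight xs" "xs \<noteq> []" "set xs = X" "int (per nb (set xs)) \<le> q" "int (length xs) = K"
    using xs by (auto simp: spiral_def)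
  have "tight (xs @ map g [0..<n])" "int (per nb (set (xs @ map g [0..<n]))) \<le> q + 1"
    by (rule tight_append_bar [OF X(1,2,4) inj _ chain _ n(1)]; use new contact size X(3,5) in blast)+
  then show ?thesis
    using xs n(2) unfolding spiral_def
    by (intro exI [of _ "xs @ map g [0..<n]"]) (auto simp: Y atLeast0LessThan)
qed

section \<open>From the hexagon of side \<open>R\<close> to that of side \<open>R + 1\<close> by six
  bars\<close>

lemmas hexagon_simps = hexagon_def diag_def ex_less3

text \<open>The six bars have \<open>2*R-1\<close>, four times \<open>2*R+1\<close>, and
  \<open>2*R+3\<close> faces, in total \<open>6*(R+1)^2 - 6*R^2\<close>. Each widens one range of
  strips and raises the perimeter bound by 1.\<close>

lemma hexagon_bar1:
  assumes "R \<ge> 1" "spiral (6*R) (6*R^2) (hexagon (-R) (R-1) (-R) (R-1) (-R) (R-1)) xs"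
  shows "\<exists>xs. spiral (6*R+1) (6*R^2+2*R-1) (hexagon (-R) R (-R) (R-1) (-R) (R-1)) xs"
proof -
  have "\<exists>xs. spiral (6*R+1) (6*R^2 + 2*(R-1)+1) (hexagon (-R) R (-R) (R-1) (-R) (R-1)) xs"
    by (rule spiral_bar [OF assms(2), where c = "\<lambda>s. (R, s-R, True)" and l = "\<lambda>s. (R, s-R, False)"
          and w = "\<lambda>f. fst (snd f) + R" and u = True])
      (use assms(1) in \<open>auto simp: hexagon_simps power2_eq_square algebra_simps\<close>)
  then show ?thesis by (simp add: algebra_simps)
qed

lemma hexagon_bar2:
  assumes "R \<ge> 1" "spiral (6*R+1) (6*R^2+2*R-1) (hexagon (-R) R (-R) (R-1) (-R) (R-1)) xs"
  shows "\<exists>xs. spiral (6*R+2) (6*R^2+4*R) (hexagon (-R) R (-R) (R-1) (-R) R) xs"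
proof -
  have "\<exists>xs. spiral (6*R+1+1) (6*R^2+2*R-1 + 2*R+1) (hexagon (-R) R (-R) (R-1) (-R) R) xs"
    by (rule spiral_bar [OF assms(2), where c = "\<lambda>s. (s, R-1-s, False)" and l = "\<lambda>s. (s+1, R-1-s, True)"
          and w = "\<lambda>f. R - 1 - fst (snd f)" and u = False])
      (use assms(1) in \<open>auto simp: hexagon_simps power2_eq_square algebra_simps\<close>)
  then show ?thesis by (simp add: algebra_simps)
qed

lemma hexagon_bar3:
  assumes "R \<ge> 1" "spiral (6*R+2) (6*R^2+4*R) (hexagon (-R) R (-R) (R-1) (-R) R) xs"
  shows "\<exists>xs. spiral (6*R+3) (6*R^2+6*R+1) (hexagon (-R) R (-R) R (-R) R) xs"
proof -
  have "\<exists>xs. spiral (6*R+2+1) (6*R^2+4*R + 2*R+1) (hexagon (-R) R (-R) R (-R) R) xs"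
    by (rule spiral_bar [OF assms(2), where c = "\<lambda>s. (s-R, R, True)" and l = "\<lambda>s. (s-R, R, False)"
          and w = "\<lambda>f. fst f + R" and u = True])
      (use assms(1) in \<open>auto simp: hexagon_simps power2_eq_square algebra_simps\<close>)
  then show ?thesis by (simp add: algebra_simps)
qed

lemma hexagon_bar4:
  assumes "R \<ge> 1" "spiral (6*R+3) (6*R^2+6*R+1) (hexagon (-R) R (-R) R (-R) R) xs"
  shows "\<exists>xs. spiral (6*R+4) (6*R^2+8*R+2) (hexagon (-R-1) R (-R) R (-R) R) xs"
proof -
  have "\<exists>xs. spiral (6*R+3+1) (6*R^2+6*R+1 + 2*R+1) (hexagon (-R-1) R (-R) R (-R) R) xs"
    by (rule spiral_bar [OF assms(2), where c = "\<lambda>s. (-R-1, s, False)" and l = "\<lambda>s. (-R-1, s+1, True)"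
          and w = "\<lambda>f. fst (snd f) - (if snd (snd f) then 1 else 0)" and u = False])
      (use assms(1) in \<open>auto simp: hexagon_simps power2_eq_square algebra_simps\<close>)
  then show ?thesis by (simp add: algebra_simps)
qed

lemma hexagon_bar5:
  assumes "R \<ge> 1" "spiral (6*R+4) (6*R^2+8*R+2) (hexagon (-R-1) R (-R) R (-R) R) xs"
  shows "\<exists>xs. spiral (6*R+5) (6*R^2+10*R+3) (hexagon (-R-1) R (-R) R (-R-1) R) xs"
proof -
  have "\<exists>xs. spiral (6*R+4+1) (6*R^2+8*R+2 + 2*R+1) (hexagon (-R-1) R (-R) R (-R-1) R) xs"
    by (rule spiral_bar [OF assms(2), where c = "\<lambda>s. (s-R-1, -s, True)" and l = "\<lambda>s. (s-R-1, -s-1, False)"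
          and w = "\<lambda>f. fst f + R + 1" and u = True])
      (use assms(1) in \<open>auto simp: hexagon_simps power2_eq_square algebra_simps\<close>)
  then show ?thesis by (simp add: algebra_simps)
qed

lemma hexagon_bar6:
  assumes "R \<ge> 1" "spiral (6*R+5) (6*R^2+10*R+3) (hexagon (-R-1) R (-R) R (-R-1) R) xs"
  shows "\<exists>xs. spiral (6*(R+1)) (6*(R+1)^2) (hexagon (-R-1) R (-R-1) R (-R-1) R) xs"
proof -
  have "\<exists>xs. spiral (6*R+5+1) (6*R^2+10*R+3 + 2*(R+1)+1) (hexagon (-R-1) R (-R-1) R (-R-1) R) xs"
    by (rule spiral_bar [OF assms(2), where c = "\<lambda>s. (s-1, -R-1, False)" and l = "\<lambda>s. (s, -R-1, True)"
          and w = "\<lambda>f. fst f + (if snd (snd f) then 0 else 1)" and u = False])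
      (use assms(1) in \<open>auto simp: hexagon_simps power2_eq_square algebra_simps\<close>)
  then show ?thesis by (simp add: power2_eq_square algebra_simps)
qed

text \<open>The six faces around a vertex have successive perimeters 3, 4, 5, 6, 7 and 6; the last
  face closes the ring and touches two others.\<close>

lemma spiral_1: "\<exists>xs. spiral 6 6 (hexagon (-1) 0 (-1) 0 (-1) 0) xs"
proof -
  define xs :: "face list" where
    "xs = [(0,0,True), (-1,0,False), (-1,0,True), (-1,-1,False), (0,-1,True), (0,-1,False)]"
  have hex: "set xs = hexagon (-1) 0 (-1) 0 (-1) 0"
  proof (intro equalityI subsetI)
    fix f assume "f \<in> hexagon (-1) 0 (-1) 0 (-1) 0"
    then have "fst f = -1 \<or> fst f = 0" "fst (snd f) = -1 \<or> fst (snd f) = 0"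
      "-1 \<le> diag f" "diag f \<le> 0" by (auto simp: hexagon_def)
    then show "f \<in> set xs" by (cases f) (auto simp: xs_def diag_def)
  qed (auto simp: xs_def hexagon_simps)
  note ins = per_insert [of _ _ nb, OF _ _ nb_nb nb_neq]
  have p1: "int (per nb {(0,0,True)}) = 3"
    using ins [of "{}" "(0,0,True)"] by (simp add: sum3)
  have p2: "int (per nb (insert (-1,0,False) {(0,0,True)})) = 4"
    by (subst ins) (auto simp: sum3 p1)
  have p3: "int (per nb (insert (-1,0,True) (insert (-1,0,False) {(0,0,True)}))) = 5"
    by (subst ins) (auto simp: sum3 p2)
  have p4: "int (per nb (insert (-1,-1,False) (insert (-1,0,True) (insert (-1,0,False) {(0,0,True)})))) = 6"
    by (subst ins) (auto simp: sum3 p3)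
  have p5: "int (per nb (insert (0,-1,True) (insert (-1,-1,False) (insert (-1,0,True)
      (insert (-1,0,False) {(0,0,True)}))))) = 7"
    by (subst ins) (auto simp: sum3 p4)
  have p6: "int (per nb (insert (0,-1,False) (insert (0,-1,True) (insert (-1,-1,False) (insert (-1,0,True)
      (insert (-1,0,False) {(0,0,True)})))))) = 6"
    by (subst ins) (auto simp: sum3 p5)
  have "tight xs" unfolding tight_def
  proof (intro conjI allI impI)
    fix k assume "0 < k \<and> k \<le> length xs"
    then have "k \<in> {1, 2, 3, 4, 5, 6}" by (auto simp: xs_def)
    then show "(int (per nb (set (take k xs))) - 2)^2 < 6 * int k"
      using p1 p2 p3 p4 p5 p6 by (auto simp: xs_def insert_commute)
  qed (simp add: xs_def)
  moreover have "int (per nb (set xs)) = 6" using p6 by (simp add: xs_def insert_commute)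
  ultimately show ?thesis
    unfolding spiral_def hex [symmetric] by (intro exI [of _ xs]) (simp add: xs_def)
qed

lemma spiral_hexagon:
  fixes R :: nat
  assumes "R \<ge> 1"
  shows "\<exists>xs. spiral (6 * int R) (6 * int R^2)
    (hexagon (- int R) (int R - 1) (- int R) (int R - 1) (- int R) (int R - 1)) xs"
  using assms
proof (induction R rule: nat_induct_at_least)
  case base
  then show ?case using spiral_1 by simp
next
  case (Suc R)
  let ?R = "int R"
  have "?R \<ge> 1" using Suc by simp
  note bars = hexagon_bar1 [OF this] hexagon_bar2 [OF this] hexagon_bar3 [OF this]
    hexagon_bar4 [OF this] hexagon_bar5 [OF this] hexagon_bar6 [OF this]
  have "\<exists>xs. spiral (6*(?R+1)) (6*(?R+1)^2) (hexagon (-?R-1) ?R (-?R-1) ?R (-?R-1) ?R) xs"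
    using Suc.IH bars by blast
  moreover have e: "- int (Suc R) = - ?R - 1" "int (Suc R) - 1 = ?R" "int (Suc R) = ?R + 1" by simp_all
  ultimately show ?case unfolding e(1,2) unfolding e(3) by blast
qed

text \<open>Serves the torus with \<open>L = 6\<close>: there the hexagon of side 3 is too wide to
  embed, and the one of side 2 has no negative energy since \<open>j \<ge> 2\<close>.\<close>

lemma spiral_hexagon_3:
  "\<exists>xs. spiral 15 37 (hexagon (-2) 2 (-2) 2 (-2) 2) xs"
proof -
  have "\<exists>xs. spiral (6*2) (6*2^2) (hexagon (-2) (2-1) (-2) (2-1) (-2) (2-1)) xs"
    using spiral_hexagon [of 2] by simp
  moreover have "1 \<le> (2::int)" by simp
  ultimately have "\<exists>xs. spiral (6*2+3) (6*2^2+6*2+1) (hexagon (-2) 2 (-2) 2 (-2) 2) xs"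
    using hexagon_bar1 hexagon_bar2 hexagon_bar3 by blast
  then show ?thesis by simp
qed

subsection \<open>The critical droplet\<close>

text \<open>These are the energy gaps at \<open>d = 0\<close>, \<open>d = 1/2\<close> and
  \<open>d = 1\<close> in \<open>critical_maximum\<close>. Some of them, such as
  \<open>6*t^2 - 4*t\<close>, are negative between integers; integrality enters through
  \<open>\<bar>s\<bar> \<le> s^2\<close> for \<open>s = t\<close> and
  \<open>s = t - 1\<close>.\<close>

lemma int_quadratics_nonneg:
  fixes t i c :: int
  assumes "(i, c) \<in> {(0, 2), (1, 1), (2, 2), (3, 3), (4, 4), (5, 5)}"
  shows "6*t^2 + (2*i-6)*t + c - i \<ge> 0" "6*t^2 + (2*i-12)*t + c + 5 - 2*i \<ge> 0"
    "6*t^2 + (2*i-18)*t + 12 - 3*i + c \<ge> 0"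
proof -
  have sq: "s \<le> s^2 \<and> - s \<le> s^2" for s :: int
  proof -
    have "\<bar>s\<bar> \<le> s^2" using self_le_power [of "\<bar>s\<bar>" 2] by (cases "s = 0") auto
    then show ?thesis by linarith
  qed
  have "(t - 1)^2 = t^2 - 2*t + 1" by (simp add: power2_eq_square algebra_simps)
  then have "t \<le> t^2" "- t \<le> t^2" "t - 1 \<le> t^2 - 2*t + 1" "1 - t \<le> t^2 - 2*t + 1"
    using sq [of t] sq [of "t - 1"] by auto
  then show "6*t^2 + (2*i-6)*t + c - i \<ge> 0" "6*t^2 + (2*i-12)*t + c + 5 - 2*i \<ge> 0"
    "6*t^2 + (2*i-18)*t + 12 - 3*i + c \<ge> 0"
    using assms by auto
qed

text \<open>Along the spiral the perimeter \<open>q\<close> first occurs at the least area \<open>k\<close> of the parity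
  of \<open>q\<close> with \<open>(q - 2)\<^sup>2 < 6 * k\<close>; in each residue class of \<open>q\<close> modulo 6
  the energy at these areas is a concave quadratic. With \<open>q = 6 * (\<rho> + t) + i + 2\<close> its gap
  to the critical energy is affine in \<open>d\<close>, hence it suffices to look at \<open>d \<in> {0, 1/2, 1}\<close>.\<close>
lemma critical_maximum:
  fixes q k \<rho> :: int and d :: real
  assumes d: "0 \<le> d" "d \<le> 1" and k: "(q - 2)^2 < 6 * k" "even q = even k"
  defines "j \<equiv> 2 * real_of_int \<rho> + 1 + 2 * d"
  shows "d \<le> 1/2 \<Longrightarrow> j * q - k \<le> j * (6 * \<rho> + 7) - (6 * \<rho>^2 + 10 * \<rho> + 5)"
    and "d \<ge> 1/2 \<Longrightarrow> j * q - k \<le> j * (6 * \<rho> + 9) - (6 * (\<rho> + 1)^2 + 2 * (\<rho> + 1) + 1)"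
proof -
  define s i t where "s = (q - 2) div 6" and "i = (q - 2) mod 6" and "t = s - \<rho>"
  have q: "q = 6 * s + i + 2" by (simp add: s_def i_def algebra_simps)
  have "i \<in> {0..<6}" by (simp add: i_def)
  then have i: "i \<in> {0, 1, 2, 3, 4, 5}" by auto
  \<comment> \<open>The least admissible \<open>k\<close> is \<open>6*s^2 + 2*i*s + c\<close>. For
    \<open>i = 0\<close> strictness and parity together raise the offset to 2.\<close>
  define c where "c = (if i = 0 then 2 else i)"
  have "(q - 2)^2 = 36 * (s * s) + 12 * (s * i) + i * i"
    by (simp add: q power2_eq_square algebra_simps)
  moreover obtain m where m: "s * s = m" by simp
  ultimately have "36 * m + 12 * (s * i) + i * i < 6 * k" using k by simp
  then have "k \<ge> 6 * m + 2 * (i * s) + c"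
    using i k(2) unfolding q c_def by auto presburger+
  then have "real_of_int (6 * (s * s) + 2 * (i * s) + c) \<le> real_of_int k" by (simp only: m of_int_le_iff)
  then have k': "real_of_int k \<ge> 6 * (\<rho> + t)^2 + 2 * (i * (\<rho> + t)) + c"
    by (simp add: t_def power2_eq_square)
  have q': "real_of_int q = 6 * (\<rho> + t) + i + 2" by (simp add: q t_def)
  have "(i, c) \<in> {(0, 2), (1, 1), (2, 2), (3, 3), (4, 4), (5, 5)}" using i by (auto simp: c_def)
  note quad = int_quadratics_nonneg [OF this, of t]
  have e: "real_of_int (6*t^2 + (2*i-6)*t + c - i) \<ge> 0" "real_of_int (6*t^2 + (2*i-12)*t + c + 5 - 2*i) \<ge> 0"
    "real_of_int (6*t^2 + (2*i-18)*t + 12 - 3*i + c) \<ge> 0"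
    using quad by (simp_all only: of_int_0_le_iff)
  show "j * q - k \<le> j * (6 * \<rho> + 7) - (6 * \<rho>^2 + 10 * \<rho> + 5)" if "d \<le> 1/2"
  proof -
    have "0 \<le> (1 - 2*d) * real_of_int (6*t^2 + (2*i-6)*t + c - i)
        + 2*d * real_of_int (6*t^2 + (2*i-12)*t + c + 5 - 2*i)"
      using that d e by (intro add_nonneg_nonneg mult_nonneg_nonneg) auto
    also have "\<dots> = j * (6 * \<rho> + 7) - (6 * \<rho>^2 + 10 * \<rho> + 5)
        - (j * q - (6 * (\<rho> + t)^2 + 2 * (i * (\<rho> + t)) + c))"
      unfolding q' j_def by (simp add: power2_eq_square algebra_simps)
    finally show ?thesis using k' by simp
  qed
  show "j * q - k \<le> j * (6 * \<rho> + 9) - (6 * (\<rho> + 1)^2 + 2 * (\<rho> + 1) + 1)" if "d \<ge> 1/2"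
  proof -
    have "0 \<le> (2 - 2*d) * real_of_int (6*t^2 + (2*i-12)*t + c + 5 - 2*i)
        + (2*d - 1) * real_of_int (6*t^2 + (2*i-18)*t + 12 - 3*i + c)"
      using that d e by (intro add_nonneg_nonneg mult_nonneg_nonneg) auto
    also have "\<dots> = j * (6 * \<rho> + 9) - (6 * (\<rho> + 1)^2 + 2 * (\<rho> + 1) + 1)
        - (j * q - (6 * (\<rho> + t)^2 + 2 * (i * (\<rho> + t)) + c))"
      unfolding q' j_def by (simp add: power2_eq_square algebra_simps)
    finally show ?thesis using k' by simp
  qed
qed

locale hexagonal_ising =
  fixes J h :: real and L :: nat
  assumes h_pos: "0 < h" and J_ge: "2 * h \<le> J" and L_large: "real (card (Lam L)) \<ge> (4 * J / h)^2"
begin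

text \<open>In units of \<open>h\<close> the energy is \<open>j\<close> times the perimeter minus
  the area.\<close>

definition j :: real where "j = J / h"

lemma h_mult_j: "h * (j * x) = J * x"
  using h_pos by (simp add: j_def)

lemma j_ge: "2 \<le> j"
  using h_pos J_ge by (simp add: j_def pos_le_divide_eq mult.commute)

lemma L_sq: "8 * j^2 \<le> (real L)^2"
  using L_large by (simp add: card_Lam j_def power_divide power_mult_distrib)

text \<open>\<open>14/5\<close> is a rational number below the square root of 8, fit for linear
  arithmetic.\<close>

lemma L_ge: "14/5 * j \<le> real L"
proof -
  have "(14/5 * j)^2 = 196/25 * j^2" by (simp add: power_mult_distrib power2_eq_square)
  then have "(14/5 * j)^2 \<le> (real L)^2" using L_sq zero_le_power2 [of j] by linarith
  then show ?thesis by (rule power2_le_imp_le) simp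
qed

lemma L_ge_6: "6 \<le> L"
  using L_ge j_ge by linarith

lemma j_decomp: "j = 2 * real_of_int (r_star J h) + 1 + 2 * delta J h"
  "0 \<le> delta J h" "delta J h < 1" "0 \<le> r_star J h"
proof -
  have e: "J / (2 * h) - 1/2 = j / 2 - 1/2" by (simp add: j_def)
  show "j = 2 * real_of_int (r_star J h) + 1 + 2 * delta J h" unfolding delta_def e by simp
  show "0 \<le> delta J h" "delta J h < 1" unfolding delta_def r_star_def by linarith+
  show "0 \<le> r_star J h" unfolding r_star_def e using j_ge by (simp add: le_floor_iff)
qed

text \<open>\<open>n\<close> and \<open>p\<close> are the area and perimeter of the critical
  droplet. The second equation puts \<open>6 * n\<close> just above \<open>(p - 2)^2\<close>, so
  parity will force perimeter \<open>p\<close> at area \<open>n\<close>. The last two bounds keep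
  the droplet small compared with the torus.\<close>

lemma critical_droplet:
  obtains n p :: nat where "Gamma_Hex J h = J * real p - h * real n" "6 * int n = (int p - 2)^2 + 5"
    "odd n" "odd p" "p \<ge> 2" "real p - 1 \<le> 4 * j" "real n \<le> 12/5 * j^2"
proof (cases "delta J h < 1/2")
  case True
  define r where "r = nat (r_star J h)"
  have r: "real_of_int (r_star J h) = real r" using j_decomp(4) by (simp add: r_def)
  have j: "j = 2 * real r + 1 + 2 * delta J h" using j_decomp(1) r by simp
  then have "real r > 0" using True j_ge by linarith
  then have r1: "real r \<ge> 1" by simp
  have jr: "2 * real r + 1 \<le> j" using j j_decomp(2) by simp
  show thesis
  proof (rule that [of "6 * r + 7" "6 * r^2 + 10 * r + 5"])
    show "Gamma_Hex J h = J * real (6 * r + 7) - h * real (6 * r^2 + 10 * r + 5)"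
      using True by (simp add: Gamma_Hex_def Let_def r algebra_simps)
    show "6 * int (6 * r^2 + 10 * r + 5) = (int (6 * r + 7) - 2)^2 + 5"
      by (simp add: power2_eq_square algebra_simps)
    show "real (6 * r + 7) - 1 \<le> 4 * j" using jr r1 by simp
    have "(2 * real r + 1)^2 \<le> j^2" using jr by (intro power_mono) auto
    moreover have "(real r)^2 \<ge> real r" using r1 by (simp add: self_le_power)
    moreover have "(2 * real r + 1)^2 = 4 * (real r)^2 + 4 * real r + 1"
      by (simp add: power2_eq_square algebra_simps)
    \<comment> \<open>For \<open>r = 1\<close> the area is 21 and \<open>j\<close> is at least 3, so
      the constant must be at least \<open>7/3\<close>; \<open>12/5\<close> is slightly
      larger.\<close>
    ultimately have "6 * (real r)^2 + 10 * real r + 5 \<le> 12/5 * j^2" using r1 by linarith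
    then show "real (6 * r^2 + 10 * r + 5) \<le> 12/5 * j^2" by simp
  qed auto
next
  case False
  define r where "r = nat (r_star J h + 1)"
  have r: "real_of_int (r_star J h) + 1 = real r" using j_decomp(4) by (simp add: r_def)
  have r1: "real r \<ge> 1" using r j_decomp(4) by simp
  have jr: "2 * real r \<le> j" using j_decomp(1) False r by simp
  show thesis
  proof (rule that [of "6 * r + 3" "6 * r^2 + 2 * r + 1"])
    show "Gamma_Hex J h = J * real (6 * r + 3) - h * real (6 * r^2 + 2 * r + 1)"
      using False unfolding Gamma_Hex_def Let_def r by (simp add: algebra_simps)
    show "6 * int (6 * r^2 + 2 * r + 1) = (int (6 * r + 3) - 2)^2 + 5"
      by (simp add: power2_eq_square algebra_simps)
    show "real (6 * r + 3) - 1 \<le> 4 * j" using jr r1 by simp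
    have "(2 * real r)^2 \<le> j^2" using jr by (intro power_mono) auto
    moreover have "(real r)^2 \<ge> real r" using r1 by (simp add: self_le_power)
    moreover have "(2 * real r)^2 = 4 * (real r)^2" by (simp add: power2_eq_square)
    ultimately have "6 * (real r)^2 + 2 * real r + 1 \<le> 12/5 * j^2" using r1 by linarith
    then show "real (6 * r^2 + 2 * r + 1) \<le> 12/5 * j^2" by simp
  qed auto
qed

lemma energy_le_Gamma:
  fixes q k :: nat
  assumes "(int q - 2)^2 < 6 * int k" "even q = even k"
  shows "J * real q - h * real k \<le> Gamma_Hex J h"
proof -
  let ?r = "r_star J h" and ?d = "delta J h"
  have m: "?d \<le> 1/2 \<Longrightarrow> j * real q - real k \<le> j * (6 * ?r + 7) - (6 * ?r^2 + 10 * ?r + 5)"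
    "?d \<ge> 1/2 \<Longrightarrow> j * real q - real k \<le> j * (6 * ?r + 9) - (6 * (?r + 1)^2 + 2 * (?r + 1) + 1)"
    using critical_maximum [of ?d "int q" "int k" ?r] assms j_decomp by auto
  show ?thesis
  proof (cases "?d < 1/2")
    case True
    have "h * (j * real q - real k) \<le> h * (j * (6 * real_of_int ?r + 7) - (6 * real_of_int ?r^2 + 10 * real_of_int ?r + 5))"
      using m(1) True h_pos by (intro mult_left_mono) auto
    also have "\<dots> = Gamma_Hex J h"
      unfolding right_diff_distrib [of h] h_mult_j using True by (simp add: Gamma_Hex_def Let_def algebra_simps)
    finally show ?thesis by (simp add: h_mult_j right_diff_distrib)
  next
    case False
    have "h * (j * real q - real k) \<le> h * (j * (6 * real_of_int ?r + 9) - (6 * (real_of_int ?r + 1)^2 + 2 * (real_of_int ?r + 1) + 1))"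
      using m(2) False h_pos by (intro mult_left_mono) auto
    also have "\<dots> = Gamma_Hex J h"
      unfolding right_diff_distrib [of h] h_mult_j using False by (simp add: Gamma_Hex_def Let_def algebra_simps)
    finally show ?thesis by (simp add: h_mult_j right_diff_distrib)
  qed
qed

lemma Gamma_gt: "2 * J < Gamma_Hex J h"
  using energy_le_Gamma [of 3 1] h_pos J_ge by simp

text \<open>With perimeter at most \<open>4 * j\<close>, the non-planar alternative would give
  \<open>L * (L - 2*j) \<le> 2 * j^2\<close>, whereas the size of the torus makes the left side at
  least \<open>56/25 * j^2\<close>.\<close>

lemma droplet_isoperimetry:
  assumes S: "S \<subseteq> Lam L" and small: "real (card S) \<le> 4 * j^2"
  shows "4 * j < real (per (tnb L) S) \<or> 6 * card S \<le> (per (tnb L) S)^2"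
proof (rule disjCI)
  assume no: "\<not> 6 * card S \<le> (per (tnb L) S)^2"
  show "4 * j < real (per (tnb L) S)"
  proof (rule ccontr)
    assume "\<not> 4 * j < real (per (tnb L) S)"
    then have "real L * real (per (tnb L) S) \<le> real L * (4 * j)" by (intro mult_left_mono) auto
    moreover have "2 * L^2 \<le> L * per (tnb L) S + card S"
      using torus_isoperimetry [OF _ S] L_ge_6 no by auto
    then have "real (2 * L^2) \<le> real (L * per (tnb L) S + card S)" by (simp only: of_nat_le_iff)
    ultimately have "2 * (real L)^2 - 4 * (j * real L) \<le> 4 * j^2"
      using small by (simp add: algebra_simps)
    moreover have "(14/5 * j) * (4/5 * j) \<le> real L * (real L - 2 * j)"
      using L_ge j_ge by (intro mult_mono) auto
    then have "56/25 * j^2 \<le> (real L)^2 - 2 * (j * real L)" by (simp add: power2_eq_square algebra_simps)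
    moreover have "0 < j^2" using j_ge by simp
    ultimately show False by linarith
  qed
qed

text \<open>In the planar case \<open>n^2 \<le> 6 * j^2 * n \<le> (j * p)^2\<close>. Hence a set of
  negative energy exceeds the critical area, and paths to it from all-minus must cross that
  area.\<close>

lemma energy_nonneg:
  assumes "S \<subseteq> Lam L" "real (card S) \<le> 12/5 * j^2"
  shows "0 \<le> energy J h L S"
proof -
  let ?p = "real (per (tnb L) S)" and ?n = "real (card S)"
  have j2: "j^2 \<ge> 0" by simp
  have "?n \<le> j * ?p"
  proof (cases "4 * j < ?p")
    case True
    have "12/5 * j^2 \<le> j * (4 * j)" using j2 by (simp add: power2_eq_square)
    also have "\<dots> \<le> j * ?p" using True j_ge by (intro mult_left_mono) auto
    finally show ?thesis using assms(2) by simp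
  next
    case False
    then have "6 * card S \<le> (per (tnb L) S)^2"
      using droplet_isoperimetry [OF assms(1)] assms(2) j2 by auto
    then have "real (6 * card S) \<le> real ((per (tnb L) S)^2)" by (simp only: of_nat_le_iff)
    then have "j^2 * (6 * ?n) \<le> j^2 * ?p^2" using j2 by (intro mult_left_mono) auto
    moreover have "?n * ?n \<le> (6 * j^2) * ?n" using assms(2) j2 by (intro mult_right_mono) auto
    ultimately have "?n^2 \<le> (j * ?p)^2"
      by (simp add: power_mult_distrib power2_eq_square algebra_simps)
    then show ?thesis using j_ge by (auto intro: power2_le_imp_le)
  qed
  then have "h * ?n \<le> h * (j * ?p)" using h_pos by (intro mult_left_mono) auto
  then show ?thesis by (simp add: energy_def h_mult_j)
qed

text \<open>Isoperimetry makes the perimeter larger than \<open>p - 2\<close>, and oddness then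
  lifts it to \<open>p\<close>. A perimeter above \<open>4 * j\<close> is at least \<open>p\<close>
  anyway.\<close>

lemma critical_energy:
  obtains n :: nat where "real n \<le> 12/5 * j^2"
    "\<And>S. S \<subseteq> Lam L \<Longrightarrow> card S = n \<Longrightarrow> Gamma_Hex J h \<le> energy J h L S"
proof -
  obtain n p :: nat where np: "Gamma_Hex J h = J * real p - h * real n" "6 * int n = (int p - 2)^2 + 5"
    "odd n" "odd p" "p \<ge> 2" "real p - 1 \<le> 4 * j" "real n \<le> 12/5 * j^2"
    by (rule critical_droplet)
  have "Gamma_Hex J h \<le> energy J h L S" if S: "S \<subseteq> Lam L" "card S = n" for S
  proof -
    let ?p = "per (tnb L) S"
    have "real (card S) \<le> 4 * j^2" using np(7) S by simp
    then consider "4 * j < real ?p" | "6 * n \<le> ?p^2"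
      using droplet_isoperimetry [OF S(1)] S(2) by auto
    then have "p \<le> ?p"
    proof cases
      case 1
      then show ?thesis using np(6) by linarith
    next
      case 2
      then have "int (6 * n) \<le> int (?p^2)" by (simp only: of_nat_le_iff)
      then have "(int p - 2)^2 < (int ?p)^2" using np(2) by simp
      then have "int p - 2 < int ?p" by (rule power2_less_imp_less) simp
      moreover have "odd ?p" using per_parity_torus [OF _ S(1)] L_ge_6 S(2) np(3) by auto
      moreover have "p \<le> m" if "int p - 2 < int m" "odd m" for m
        using that np(4) by presburger
      ultimately show ?thesis by blast
    qed
    then show ?thesis using h_pos J_ge by (simp add: energy_def np(1) S(2))
  qed
  then show thesis using np(7) that by blast
qed

end

section \<open>Copies of planar sets on the torus, and connectedness\<close>

lemma per_shift:
  assumes inj: "inj \<psi>" and comm: "\<And>i f. nb i (\<psi> f) = \<psi> (nb i f)"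
  shows "per nb (\<psi> ` T) = per nb T"
proof -
  have "{z \<in> \<psi> ` T. nb i z \<notin> \<psi> ` T} = \<psi> ` {f \<in> T. nb i f \<notin> T}" for i
    using inj by (auto simp: comm inj_eq simp del: nb.simps split_paired_All split_paired_Ex)
  then have "card {z \<in> \<psi> ` T. nb i z \<notin> \<psi> ` T} = card {f \<in> T. nb i f \<notin> T}" for i
    using inj by (simp add: card_image inj_on_subset)
  then show ?thesis by (simp add: per_def)
qed

text \<open>A downward face is reached from the origin by the point reflection, which swaps the
  orientations.\<close>
lemma embed_at:
  assumes L: "w < int L" "L > 0" and x: "x \<in> Lam L" and X: "X \<subseteq> window w a0 b0"
  obtains \<phi> where "\<phi> (0, 0, True) = x" "\<phi> ` X \<subseteq> Lam L" "inj_on \<phi> X"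
    "\<And>i. \<phi> (nb i (0, 0, True)) = tnb L i x" "\<And>T. T \<subseteq> X \<Longrightarrow> per (tnb L) (\<phi> ` T) = per nb T"
proof -
  obtain a b u where l: "lift x = (a, b, u)" by (cases "lift x")
  define \<psi> :: "face \<Rightarrow> face" where
    "\<psi> f = (if u then (a + fst f, b + fst (snd f), snd (snd f))
            else (a - fst f, b - fst (snd f), \<not> snd (snd f)))" for f
  \<comment> \<open>The reflection maps the range from \<open>a0\<close> to
    \<open>a0 + w - 1\<close> onto that from \<open>a - a0 - w + 1\<close> to
    \<open>a - a0\<close>.\<close>
  define a1 b1 where "a1 = (if u then a + a0 else a - a0 - w + 1)"
    and "b1 = (if u then b + b0 else b - b0 - w + 1)"
  have comm: "nb i (\<psi> f) = \<psi> (nb i f)" for i f by (cases f) (auto simp: \<psi>_def)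
  have inj: "inj \<psi>" by (auto simp: inj_def \<psi>_def prod_eq_iff)
  have win: "\<psi> ` X \<subseteq> window w a1 b1"
  proof
    fix z assume "z \<in> \<psi> ` X"
    then obtain f where "f \<in> window w a0 b0" "z = \<psi> f" using X by auto
    then show "z \<in> window w a1 b1" by (auto simp: window_def \<psi>_def a1_def b1_def)
  qed
  have "\<psi> (0, 0, True) = lift x" by (simp add: \<psi>_def l)
  then have x0: "(proj L \<circ> \<psi>) (0, 0, True) = x" using x by simp
  show thesis
  proof (rule that [of "proj L \<circ> \<psi>"])
    show "(proj L \<circ> \<psi>) ` X \<subseteq> Lam L" using L by auto
    show "inj_on (proj L \<circ> \<psi>) X"
      using inj_on_subset [OF inj_on_proj_window [OF L(1)] win] inj by (meson comp_inj_on inj_on_subset subset_UNIV)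
    show "(proj L \<circ> \<psi>) (nb i (0, 0, True)) = tnb L i x" for i
      using x0 L by (metis comm comp_apply tnb_proj)
    show "per (tnb L) ((proj L \<circ> \<psi>) ` T) = per nb T" if "T \<subseteq> X" for T
    proof -
      have "\<psi> ` T \<subseteq> window w a1 b1" using that win by blast
      from per_proj(1) [OF L(1) this L(2)] per_shift [OF inj comm] show ?thesis
        by (simp add: image_comp)
    qed
  qed (rule x0)
qed

text \<open>The torus is connected: direction 1 followed by direction 0 advances the first
  coordinate, direction 2 followed by direction 0 the second.\<close>

lemma tnb_closed_imp_Lam:
  assumes L: "L \<ge> 2" and S: "S \<subseteq> Lam L" "x \<in> S"
    and closed: "\<And>i x. i < 3 \<Longrightarrow> x \<in> S \<Longrightarrow> tnb L i x \<in> S"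
  shows "S = Lam L"
proof
  obtain a b u where x: "x = (a, b, u)" by (cases x)
  have lt: "a < L" "b < L" using S by (auto simp: x Lam_def)
  have flip: "(a, b, \<not> u) \<in> S" if "(a, b, u) \<in> S" "a < L" "b < L" for a b u
    using closed [of 0, OF _ that(1)] that by (simp add: tnb_cases(1) [OF L])
  have col: "((a + 1) mod L, b, False) \<in> S" if "(a, b, False) \<in> S" "a < L" "b < L" for a b
    using closed [of 1, OF _ that(1)] that flip [of "(a + 1) mod L" b True]
    by (simp add: tnb_cases [OF L] del: One_nat_def)
  have row: "(a, (b + 1) mod L, False) \<in> S" if "(a, b, False) \<in> S" "a < L" "b < L" for a b
    using closed [of 2, OF _ that(1)] that flip [of a "(b + 1) mod L" True]
    by (simp add: tnb_cases [OF L] del: One_nat_def)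
  have start: "(a, b, False) \<in> S" using flip [of a b True] S lt by (cases u) (auto simp: x)
  show "Lam L \<subseteq> S"
  proof
    fix y assume y: "y \<in> Lam L"
    obtain c d v where y': "y = (c, d, v)" by (cases y)
    have lt': "c < L" "d < L" using y by (auto simp: y' Lam_def)
    have "(c, b, False) \<in> S"
      using mod_orbit [of L "\<lambda>a. (a, b, False) \<in> S" a c] col start lt lt' by auto
    then have "(c, d, False) \<in> S"
      using mod_orbit [of L "\<lambda>b. (c, b, False) \<in> S" b d] row lt lt' by auto
    then show "y \<in> S" using flip [of c d False] lt' by (cases v) (auto simp: y')
  qed
qed (rule S(1))

subsection \<open>Stability levels\<close>

context hexagonal_ising
begin

text \<open>The hexagon has to be narrower than the torus and yet supercritical; side
  \<open>(L - 1) div 2\<close>, which exceeds \<open>j\<close>, achieves both for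
  \<open>L \<ge> 7\<close>. The last property is stated for all numbers obeying the isoperimetric
  inequality, so it applies to every proper subset.\<close>

lemma growth_list:
  obtains xs w a b where "tight xs" "xs \<noteq> []" "hd xs = (0, 0, True)" "set xs \<subseteq> window w a b" "w < int L"
    "\<And>i. nb i (0, 0, True) \<in> set xs"
    "\<And>p m :: nat. m < length xs \<Longrightarrow> 6 * m \<le> p^2 \<Longrightarrow>
      J * real (per nb (set xs)) - h * real (length xs) < J * real p - h * real m"
proof -
  have final: "J * real (per nb (set xs)) - h * real (length xs) < J * real p - h * real m"
    if xs: "spiral q K X xs" and m: "m < length xs" "6 * m \<le> p^2"
      and gap: "int p < q \<Longrightarrow> j * (real_of_int q - real p) < real_of_int K - (real p)^2 / 6" for q K X xs p m
  proof -
    have q: "real (per nb (set xs)) \<le> real_of_int q" and K: "real (length xs) = real_of_int K"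
      using xs by (auto simp: spiral_def)
    have "j * (real_of_int q - real p) < real_of_int K - real m"
    proof (cases "int p < q")
      case True
      have "real (6 * m) \<le> real (p^2)" using m(2) by (simp only: of_nat_le_iff)
      then show ?thesis using gap [OF True] by simp
    next
      case False
      then have "j * (real_of_int q - real p) \<le> 0" using j_ge by (intro mult_nonneg_nonpos) auto
      then show ?thesis using m(1) K by linarith
    qed
    then have "h * (j * (real_of_int q - real p)) < h * (real_of_int K - real m)"
      using h_pos by (intro mult_strict_left_mono)
    then have "J * real_of_int q - h * real_of_int K < J * real p - h * real m"
      unfolding h_mult_j by (simp add: right_diff_distrib)
    moreover have "J * real (per nb (set xs)) \<le> J * real_of_int q"
      using q h_pos J_ge by (intro mult_left_mono) auto
    ultimately show ?thesis using K by simp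
  qed
  show thesis
  proof (cases "L = 6")
    case True
    obtain xs where xs: "spiral 15 37 (hexagon (-2) 2 (-2) 2 (-2) 2) xs" using spiral_hexagon_3 by blast
    have "8 * j^2 \<le> 36" using L_sq True by simp
    then have "j^2 \<le> (213/100)^2" by (simp add: power2_eq_square)
    then have j_le: "j \<le> 213/100" by (rule power2_le_imp_le) simp
    show thesis
    proof (rule that [of xs 5 "-2" "-2"])
      show "set xs \<subseteq> window 5 (-2) (-2)" using xs by (auto simp: spiral_def hexagon_def window_def)
      show "nb i (0, 0, True) \<in> set xs" for i using xs by (auto simp: spiral_def hexagon_def diag_def)
      show "J * real (per nb (set xs)) - h * real (length xs) < J * real p - h * real m"
        if m: "m < length xs" "6 * m \<le> p^2" for p m
      proof (rule final [OF xs m])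
        assume "int p < 15"
        then have p: "real p \<le> 14" by simp
        then have "real p * real p \<le> 14 * real p" by (intro mult_right_mono) auto
        moreover have "j * (15 - real p) \<le> 213/100 * (15 - real p)"
          using j_le p by (intro mult_right_mono) auto
        ultimately show "j * (real_of_int 15 - real p) < real_of_int 37 - (real p)^2 / 6"
          using p by (simp add: power2_eq_square)
      qed
    qed (use xs True in \<open>auto simp: spiral_def\<close>)
  next
    case False
    then have L7: "L \<ge> 7" using L_ge_6 by simp
    define R where "R = (L - 1) div 2"
    have R: "R \<ge> 3" "2 * R < L" "L \<le> 2 * R + 2" using L7 unfolding R_def by linarith+
    obtain xs where xs: "spiral (6 * int R) (6 * int R^2)
        (hexagon (- int R) (int R - 1) (- int R) (int R - 1) (- int R) (int R - 1)) xs"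
      using spiral_hexagon [of R] R by auto
    have jR: "j < real R"
    proof -
      have "8 * j^2 \<le> (2 * real R + 2)^2"
        using L_sq power_mono [of "real L" "2 * real R + 2" 2] R(3) by linarith
      also have "\<dots> < 8 * (real R)^2"
      proof -
        have "3 * real R \<le> real R * real R" using R(1) by (intro mult_right_mono) auto
        moreover have "(2 * real R + 2)^2 = 4 * (real R * real R) + 8 * real R + 4"
          by (simp add: power2_eq_square algebra_simps)
        moreover have "real R \<ge> 3" using R(1) by simp
        ultimately show ?thesis unfolding power2_eq_square [of "real R"] by linarith
      qed
      finally have "j^2 < (real R)^2" by simp
      then show ?thesis by (rule power2_less_imp_less) simp
    qed
    show thesis
    proof (rule that [of xs "2 * int R" "- int R" "- int R"])
      show "set xs \<subseteq> window (2 * int R) (- int R) (- int R)"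
        using xs by (auto simp: spiral_def hexagon_def window_def)
      show "nb i (0, 0, True) \<in> set xs" for i
        using xs R by (auto simp: spiral_def hexagon_def diag_def)
      show "J * real (per nb (set xs)) - h * real (length xs) < J * real p - h * real m"
        if m: "m < length xs" "6 * m \<le> p^2" for p m
      proof (rule final [OF xs m])
        assume "int p < 6 * int R"
        then have p: "real p < 6 * real R" by linarith
        \<comment> \<open>\<open>6*R^2 - p^2/6\<close> factors as
          \<open>(6*R + p)/6 * (6*R - p)\<close>, whose first factor is at least
          \<open>R\<close>.\<close>
        then have "j * (6 * real R - real p) < real R * (6 * real R - real p)"
          using jR by (intro mult_strict_right_mono) auto
        also have "\<dots> \<le> (6 * real R + real p) / 6 * (6 * real R - real p)"
          using p by (intro mult_right_mono) auto
        also have "\<dots> = 6 * (real R)^2 - (real p)^2 / 6"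
          by (simp add: power2_eq_square field_simps)
        finally show "j * (real_of_int (6 * int R) - real p) < real_of_int (6 * int R^2) - (real p)^2 / 6"
          by simp
      qed
    qed (use xs R in \<open>auto simp: spiral_def\<close>)
  qed
qed

text \<open>If \<open>T\<close> has nonpositive energy then its perimeter \<open>p\<close> is at least
  \<open>6 * j\<close>, so beyond \<open>T\<close> the spiral energy no longer grows except for fluctuations
  of at most \<open>2 * J\<close>.\<close>
lemma energy_gap:
  fixes k m p q :: nat
  assumes q: "(int q - 2)^2 < 6 * int k" "even q = even k"
    and p: "6 * m \<le> p^2" and m: "0 < m" "m \<le> k"
  shows "(J * real q - h * real k) - (J * real p - h * real m) < Gamma_Hex J h"
proof (cases "0 < J * real p - h * real m")
  case True
  then show ?thesis using energy_le_Gamma [OF q] by linarith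
next
  case False
  have "h * (j * real p) \<le> h * real m" using False unfolding h_mult_j by simp
  then have jp: "j * real p \<le> real m" using h_pos by simp
  have pm: "6 * real m \<le> (real p)^2"
  proof -
    have "real (6 * m) \<le> real (p^2)" using p by (simp only: of_nat_le_iff)
    then show ?thesis by simp
  qed
  have "0 < real p" using p m(1) by (cases "p = 0") auto
  moreover have "6 * j * real p \<le> real p * real p" using pm jp by (simp add: power2_eq_square)
  ultimately have p6: "6 * j \<le> real p" by simp
  \<comment> \<open>Tightness gives \<open>y^2 < 6 * k\<close>, hence \<open>k - m\<close> dominates
    \<open>j * (y - p)\<close>. Passing from \<open>y\<close> back to \<open>q\<close> costs the
    final \<open>2 * J\<close>.\<close>
  define y where "y = real q - 2"
  have "real_of_int ((int q - 2)^2) < real_of_int (6 * int k)" using q(1) by (simp only: of_int_less_iff)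
  then have y: "y^2 < 6 * real k" by (simp add: y_def)
  have "j * (y - real p) \<le> real k - real m"
  proof (cases "y \<le> real p")
    case True
    then have "j * (y - real p) \<le> 0" using j_ge by (intro mult_nonneg_nonpos) auto
    then show ?thesis using m(2) by linarith
  next
    case False
    then have "6 * j * (y - real p) \<le> (y + real p) * (y - real p)"
      using p6 j_ge by (intro mult_right_mono) auto
    also have "\<dots> = y^2 - (real p)^2" by (simp add: power2_eq_square algebra_simps)
    finally show ?thesis using y pm by simp
  qed
  then have "h * (j * (y - real p)) \<le> h * (real k - real m)" using h_pos by (intro mult_left_mono) auto
  then have "J * (y - real p) \<le> h * (real k - real m)" by (simp only: h_mult_j)
  then have "(J * real q - h * real k) - (J * real p - h * real m) \<le> 2 * J"
    by (simp add: y_def algebra_simps)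
  then show ?thesis using Gamma_gt by simp
qed

text \<open>By submodularity, growing a spiral on top of \<open>S\<close> costs no more than growing it
  from its intersection with \<open>S\<close>.\<close>
lemma growth:
  assumes S: "S \<subseteq> Lam L" and x: "x \<in> Lam L"
  obtains ys where "set ys \<subseteq> Lam L" "\<And>i. tnb L i x \<in> set ys"
    "S = {} \<Longrightarrow> (\<forall>k\<le>length ys. energy J h L (S \<union> set (take k ys)) \<le> energy J h L S + Gamma_Hex J h)
      \<and> energy J h L (S \<union> set ys) < energy J h L S"
    "x \<in> S \<Longrightarrow> (\<forall>k\<le>length ys. energy J h L (S \<union> set (take k ys)) < energy J h L S + Gamma_Hex J h)
      \<and> (\<not> set ys \<subseteq> S \<longrightarrow> energy J h L (S \<union> set ys) < energy J h L S)"
proof -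
  obtain xs w a b where xs: "tight xs" "xs \<noteq> []" "hd xs = (0, 0, True)" "set xs \<subseteq> window w a b" "w < int L"
    "\<And>i. nb i (0, 0, True) \<in> set xs"
    and final: "\<And>p m :: nat. m < length xs \<Longrightarrow> 6 * m \<le> p^2 \<Longrightarrow>
      J * real (per nb (set xs)) - h * real (length xs) < J * real p - h * real m"
    using growth_list by blast
  have "L > 0" using L_ge_6 by simp
  obtain \<phi> where \<phi>: "\<phi> (0, 0, True) = x" "\<phi> ` set xs \<subseteq> Lam L" "inj_on \<phi> (set xs)"
    "\<And>i. \<phi> (nb i (0, 0, True)) = tnb L i x" "\<And>T. T \<subseteq> set xs \<Longrightarrow> per (tnb L) (\<phi> ` T) = per nb T"
    using embed_at [OF xs(5) \<open>L > 0\<close> x xs(4)] by blast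
  define E where "E T = J * real (per nb T) - h * real (card T)" for T
  define T where "T k = {f \<in> set (take k xs). \<phi> f \<in> S}" for k
  let ?ys = "map \<phi> xs"
  have E: "energy J h L (\<phi> ` A) = E A" if "A \<subseteq> set xs" for A
    using that \<phi>(5) [OF that] card_image [OF inj_on_subset [OF \<phi>(3) that]] by (simp add: energy_def E_def)
  have sub: "set (take k xs) \<subseteq> set xs" "T k \<subseteq> set xs" for k
    using set_take_subset [of k xs] by (auto simp: T_def)
  have finS: "finite S" using S finite_Lam by (rule finite_subset)
  have step: "energy J h L (S \<union> set (take k ?ys)) \<le> energy J h L S + (E (set (take k xs)) - E (T k))" for k
  proof -
    have i: "S \<inter> \<phi> ` set (take k xs) = \<phi> ` T k" by (auto simp: T_def)
    have "energy J h L (S \<union> \<phi> ` set (take k xs)) + energy J h L (S \<inter> \<phi> ` set (take k xs))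
        \<le> energy J h L S + energy J h L (\<phi> ` set (take k xs))"
      using finS h_pos J_ge by (intro energy_submodular) auto
    then show ?thesis unfolding i using E [OF sub(1)] E [OF sub(2)] by (simp add: take_map)
  qed
  have iso: "6 * card (T k) \<le> (per nb (T k))^2" for k
    by (rule planar_isoperimetry) (simp add: T_def)
  have dist: "distinct xs" using xs(1) by (simp add: tight_def)
  then have card_take: "card (set (take k xs)) = k" if "k \<le> length xs" for k
    using that by (simp add: distinct_card)
  have tight: "(int (per nb (set (take k xs))) - 2)^2 < 6 * int k" if "0 < k" "k \<le> length xs" for k
    using xs(1) that by (simp add: tight_def)
  have parity: "even (per nb (set (take k xs))) = even k" if "k \<le> length xs" for k
    using per_parity [of "set (take k xs)" nb "\<lambda>f. snd (snd f)"] card_take [OF that]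
    by (simp del: nb.simps)
  have Tcard: "card (T k) \<le> k" if "k \<le> length xs" for k
    using card_mono [of "set (take k xs)" "T k"] card_take [OF that] by (auto simp: T_def)
  show thesis
  proof (rule that [of ?ys])
    show "set ?ys \<subseteq> Lam L" using \<phi>(2) by simp
    show "tnb L i x \<in> set ?ys" for i using xs(6) [of i] \<phi>(4) [of i] by (metis image_eqI set_map)
    show "(\<forall>k\<le>length ?ys. energy J h L (S \<union> set (take k ?ys)) \<le> energy J h L S + Gamma_Hex J h)
      \<and> energy J h L (S \<union> set ?ys) < energy J h L S" if S0: "S = {}"
    proof (intro conjI allI impI)
      have T0: "E (T k) = 0" for k using S0 by (simp add: T_def E_def)
      show "energy J h L (S \<union> set ?ys) < energy J h L S"
        using step [of "length xs"] T0 final [of 0 0] xs(2) card_take [of "length xs"] by (simp add: E_def)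
      fix k assume k: "k \<le> length ?ys"
      have "E (set (take k xs)) \<le> Gamma_Hex J h"
      proof (cases "k = 0")
        case True then show ?thesis using Gamma_gt h_pos J_ge by (simp add: E_def)
      next
        case False then show ?thesis
          using energy_le_Gamma [OF tight parity, of k] k card_take [of k] by (simp add: E_def)
      qed
      then show "energy J h L (S \<union> set (take k ?ys)) \<le> energy J h L S + Gamma_Hex J h"
        using step [of k] T0 [of k] by simp
    qed
    show "(\<forall>k\<le>length ?ys. energy J h L (S \<union> set (take k ?ys)) < energy J h L S + Gamma_Hex J h)
      \<and> (\<not> set ?ys \<subseteq> S \<longrightarrow> energy J h L (S \<union> set ?ys) < energy J h L S)" if xS: "x \<in> S"
    proof (intro conjI allI impI)
      fix k assume k: "k \<le> length ?ys"
      show "energy J h L (S \<union> set (take k ?ys)) < energy J h L S + Gamma_Hex J h"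
      proof (cases "k = 0")
        case True then show ?thesis using Gamma_gt h_pos J_ge by simp
      next
        case False
        \<comment> \<open>The spiral starts at a site of \<open>S\<close>, so the intersection is
          nonempty, as the strict bound of \<open>energy_gap\<close> requires.\<close>
        then have "(0, 0, True) \<in> T k"
          using xs(2,3) \<phi>(1) xS by (cases xs; cases k) (auto simp: T_def)
        then have "0 < card (T k)" by (auto simp: card_gt_0_iff T_def)
        then have "E (set (take k xs)) - E (T k) < Gamma_Hex J h"
          using energy_gap [OF tight parity iso _ Tcard] False k card_take [of k] by (simp add: E_def)
        then show ?thesis using step [of k] by simp
      qed
    next
      assume "\<not> set ?ys \<subseteq> S"
      then have "T (length xs) \<subset> set xs" by (auto simp: T_def)
      then have "card (T (length xs)) < card (set xs)" by (intro psubset_card_mono) auto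
      then have "card (T (length xs)) < length xs" using dist by (simp add: distinct_card)
      then have "E (set xs) < E (T (length xs))"
        using final [OF _ iso, of "length xs"] dist by (simp add: E_def distinct_card)
      then show "energy J h L (S \<union> set ?ys) < energy J h L S" using step [of "length xs"] by simp
    qed
  qed
qed

lemma Ham_less_iff:
  assumes "S \<subseteq> Lam L" "T \<subseteq> Lam L"
  shows "Ham J h L (cfg L S) < Ham J h L (cfg L T) + e \<longleftrightarrow> energy J h L S < energy J h L T + e"
    and "Ham J h L (cfg L S) \<le> Ham J h L (cfg L T) + e \<longleftrightarrow> energy J h L S \<le> energy J h L T + e"
  using assms L_ge_6 by (auto simp: Ham_cfg)

lemma Phi_set_growth:
  assumes S: "S \<subseteq> Lam L" and ys: "set ys \<subseteq> Lam L" and low: "energy J h L (S \<union> set ys) < energy J h L S"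
  obtains k where "k \<le> length ys" "Ilow J h L (cfg L S) \<noteq> {}"
    "Phi_set J h L {cfg L S} (Ilow J h L (cfg L S)) \<le> Ham J h L (cfg L (S \<union> set (take k ys)))"
proof -
  let ?\<eta> = "cfg L (S \<union> set ys)"
  have \<eta>: "?\<eta> \<in> Ilow J h L (cfg L S)"
    using Ham_less_iff(1) [of "S \<union> set ys" S 0] S ys low by (simp add: Ilow_def)
  obtain p where p: "p \<in> Paths L (cfg L S) ?\<eta>"
    "set p \<subseteq> (\<lambda>k. cfg L (S \<union> set (take k ys))) ` {..length ys}"
    by (rule path_add [OF S ys])
  have "Max (Ham J h L ` set p) \<in> Ham J h L ` set p"
    using p(1) by (intro Max_in) (auto simp: Paths_def is_path_def)
  then obtain k where k: "k \<le> length ys" "Max (Ham J h L ` set p) = Ham J h L (cfg L (S \<union> set (take k ys)))"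
    using p(2) by auto
  have "Phi_set J h L {cfg L S} (Ilow J h L (cfg L S)) \<le> Phi J h L (cfg L S) ?\<eta>"
    using \<eta> by (rule Phi_set_le) (auto simp: Ilow_def)
  also have "\<dots> \<le> Ham J h L (cfg L (S \<union> set (take k ys)))"
    using Phi_le [OF p(1), of J h] k(2) by simp
  finally show thesis using that k(1) \<eta> by blast
qed

lemma stab_level_less:
  assumes S: "S \<subseteq> Lam L" "S \<noteq> {}" "S \<noteq> Lam L"
  shows "stab_level J h L (cfg L S) < ereal (Gamma_Hex J h)" "Ilow J h L (cfg L S) \<noteq> {}"
proof -
  \<comment> \<open>The spiral around \<open>x\<close> contains all neighbours of \<open>x\<close>,
    so a neighbour outside \<open>S\<close> ensures that the spiral is not contained in
    \<open>S\<close>.\<close>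
  obtain x i where x: "x \<in> S" "tnb L i x \<notin> S"
    using tnb_closed_imp_Lam [of L S] S L_ge_6 by fastforce
  then have "x \<in> Lam L" using S by auto
  then obtain ys where ys: "set ys \<subseteq> Lam L" "tnb L i x \<in> set ys"
    "\<forall>k\<le>length ys. energy J h L (S \<union> set (take k ys)) < energy J h L S + Gamma_Hex J h"
    "\<not> set ys \<subseteq> S \<longrightarrow> energy J h L (S \<union> set ys) < energy J h L S"
    using growth [OF S(1)] x(1) by metis
  then have "energy J h L (S \<union> set ys) < energy J h L S" using x by auto
  then obtain k where k: "k \<le> length ys" "Ilow J h L (cfg L S) \<noteq> {}"
    "Phi_set J h L {cfg L S} (Ilow J h L (cfg L S)) \<le> Ham J h L (cfg L (S \<union> set (take k ys)))"
    by (rule Phi_set_growth [OF S(1) ys(1)])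
  have "S \<union> set (take k ys) \<subseteq> Lam L" using S(1) ys(1) set_take_subset [of k ys] by auto
  then have "Ham J h L (cfg L (S \<union> set (take k ys))) < Ham J h L (cfg L S) + Gamma_Hex J h"
    using Ham_less_iff(1) S(1) ys(3) k(1) by blast
  then show "stab_level J h L (cfg L S) < ereal (Gamma_Hex J h)" "Ilow J h L (cfg L S) \<noteq> {}"
    using k by (auto simp: stab_level_def)
qed

lemma stab_level_all_minus:
  "stab_level J h L (all_minus L) = ereal (Gamma_Hex J h)" "Ilow J h L (all_minus L) \<noteq> {}"
proof -
  have "(0, 0, True) \<in> Lam L" using L_ge_6 by (simp add: Lam_def)
  then obtain ys where ys: "set ys \<subseteq> Lam L"
    "\<forall>k\<le>length ys. energy J h L ({} \<union> set (take k ys)) \<le> energy J h L {} + Gamma_Hex J h"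
    "energy J h L ({} \<union> set ys) < energy J h L {}"
    using growth [of "{}"] by (metis empty_subsetI)
  obtain k where k: "k \<le> length ys" "Ilow J h L (cfg L {}) \<noteq> {}"
    "Phi_set J h L {cfg L {}} (Ilow J h L (cfg L {})) \<le> Ham J h L (cfg L ({} \<union> set (take k ys)))"
    by (rule Phi_set_growth [OF _ ys(1,3)]) auto
  show I: "Ilow J h L (all_minus L) \<noteq> {}" using k(2) by (simp add: cfg_empty)
  have "{} \<union> set (take k ys) \<subseteq> Lam L" using ys(1) set_take_subset [of k ys] by auto
  then have "Ham J h L (cfg L ({} \<union> set (take k ys))) \<le> Ham J h L (cfg L {}) + Gamma_Hex J h"
    using Ham_less_iff(2) ys(2) k(1) by blast
  then have upper: "Phi_set J h L {all_minus L} (Ilow J h L (all_minus L)) \<le> Ham J h L (all_minus L) + Gamma_Hex J h"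
    using k(3) by (simp add: cfg_empty)
  have lower: "Ham J h L (all_minus L) + Gamma_Hex J h \<le> Phi_set J h L {all_minus L} (Ilow J h L (all_minus L))"
  proof (rule Phi_set_ge [OF I])
    show "Ilow J h L (all_minus L) \<subseteq> Conf L" by (auto simp: Ilow_def)
    fix \<eta> assume \<eta>: "\<eta> \<in> Ilow J h L (all_minus L)"
    then have "\<eta> \<in> Conf L" by (simp add: Ilow_def)
    then obtain T where T: "T \<subseteq> Lam L" "\<eta> = cfg L T" by (rule Conf_cfg)
    have "energy J h L T < 0" using \<eta> T L_ge_6 by (simp add: Ilow_def Ham_cfg)
    then have large: "12/5 * j^2 < real (card T)" using energy_nonneg [OF T(1)] by linarith
    show "Ham J h L (all_minus L) + Gamma_Hex J h \<le> Phi J h L (all_minus L) \<eta>"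
    proof (rule Phi_ge)
      have "finite T" using T(1) finite_Lam by (rule finite_subset)
      then obtain zs where "set zs = T" using finite_list by auto
      then show "Paths L (all_minus L) \<eta> \<noteq> {}"
        using path_add [of "{}" L zs] T by (auto simp: cfg_empty)
      fix p assume p: "p \<in> Paths L (all_minus L) \<eta>"
      obtain n where n: "real n \<le> 12/5 * j^2"
        "\<And>S. S \<subseteq> Lam L \<Longrightarrow> card S = n \<Longrightarrow> Gamma_Hex J h \<le> energy J h L S"
        using critical_energy by blast
      have "\<exists>U. U \<subseteq> Lam L \<and> card U = n \<and> cfg L U \<in> set p"
        using p n(1) large T by (intro path_card_crosses [of L p "{}" T n]) (auto simp: Paths_def cfg_empty)
      then obtain U where "U \<subseteq> Lam L" "card U = n" "cfg L U \<in> set p" by auto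
      then show "\<exists>\<zeta>\<in>set p. Ham J h L (all_minus L) + Gamma_Hex J h \<le> Ham J h L \<zeta>"
        using n(2) L_ge_6 by (intro bexI [of _ "cfg L U"]) (auto simp: Ham_cfg)
    qed
  qed
  show "stab_level J h L (all_minus L) = ereal (Gamma_Hex J h)"
    using I upper lower by (simp add: stab_level_def)
qed

section \<open>The ground state and the metastable state\<close>

text \<open>All-plus is found by elimination: finiteness provides a minimiser of \<open>Ham\<close>,
  and every configuration other than all-plus has one of lower energy.\<close>

lemma Ilow_empty_iff:
  assumes "S \<subseteq> Lam L"
  shows "Ilow J h L (cfg L S) = {} \<longleftrightarrow> S = Lam L"
proof
  show "Ilow J h L (cfg L S) = {} \<Longrightarrow> S = Lam L"
    using stab_level_less(2) [OF assms] stab_level_all_minus(2) by (cases "S = {}") (auto simp: cfg_empty)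
  assume S: "S = Lam L"
  have ne: "Conf L \<noteq> {}" using cfg_in_Conf by blast
  obtain \<sigma> where \<sigma>: "\<sigma> \<in> Conf L" "\<And>\<eta>. \<eta> \<in> Conf L \<Longrightarrow> Ham J h L \<sigma> \<le> Ham J h L \<eta>"
    using ex_is_arg_min_if_finite [OF finite_Conf ne, of "Ham J h L"] by (auto simp: is_arg_min_linorder)
  obtain T where T: "T \<subseteq> Lam L" "\<sigma> = cfg L T" using \<sigma>(1) by (rule Conf_cfg)
  have "Ilow J h L (cfg L T) = {}" using \<sigma> T by (force simp: Ilow_def)
  then have "T = Lam L"
    using stab_level_less(2) [OF T(1)] stab_level_all_minus(2) by (cases "T = {}") (auto simp: cfg_empty)
  then show "Ilow J h L (cfg L S) = {}" using \<open>Ilow J h L (cfg L T) = {}\<close> S by simp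
qed

lemma ground_states_eq: "ground_states J h L = {all_plus L}"
proof -
  have "\<sigma> \<in> ground_states J h L \<longleftrightarrow> \<sigma> \<in> Conf L \<and> Ilow J h L \<sigma> = {}" for \<sigma>
    by (force simp: ground_states_def Ilow_def)
  moreover have "\<sigma> \<in> Conf L \<and> Ilow J h L \<sigma> = {} \<longleftrightarrow> \<sigma> = all_plus L" for \<sigma>
    using Ilow_empty_iff by (metis Conf_cfg cfg_Lam cfg_in_Conf order_refl)
  ultimately show ?thesis by blast
qed

lemma stab_level_cases:
  assumes "\<sigma> \<in> Conf L"
  shows "\<sigma> = all_plus L \<and> stab_level J h L \<sigma> = \<infinity>
    \<or> \<sigma> = all_minus L \<and> stab_level J h L \<sigma> = ereal (Gamma_Hex J h)
    \<or> stab_level J h L \<sigma> < ereal (Gamma_Hex J h)"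
proof -
  obtain S where S: "S \<subseteq> Lam L" "\<sigma> = cfg L S" using assms by (rule Conf_cfg)
  consider "S = {}" | "S = Lam L" | "S \<noteq> {}" "S \<noteq> Lam L" by blast
  then show ?thesis
  proof cases
    case 1 then show ?thesis using S stab_level_all_minus by (simp add: cfg_empty)
  next
    case 2 then show ?thesis using S Ilow_empty_iff [of "Lam L"] by (simp add: cfg_Lam stab_level_def)
  next
    case 3 then show ?thesis using S stab_level_less(1) by simp
  qed
qed

lemma metastable:
  "metastable_states J h L = {all_minus L} \<and> Gamma_m J h L = ereal (Gamma_Hex J h)"
proof -
  have minus: "all_minus L \<in> Conf L" using cfg_in_Conf [of L "{}"] by (simp add: cfg_empty)
  have ne: "all_minus L \<noteq> all_plus L"
    using stab_level_all_minus(2) Ilow_empty_iff [of "Lam L"] by (auto simp: cfg_Lam)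
  have G: "Gamma_m J h L = ereal (Gamma_Hex J h)"
    unfolding Gamma_m_def ground_states_eq
  proof (rule Max_eqI)
    show "finite (stab_level J h L ` (Conf L - {all_plus L}))" by simp
    show "ereal (Gamma_Hex J h) \<in> stab_level J h L ` (Conf L - {all_plus L})"
      using minus ne stab_level_all_minus(1) by (intro image_eqI [of _ _ "all_minus L"]) auto
    show "v \<le> ereal (Gamma_Hex J h)" if "v \<in> stab_level J h L ` (Conf L - {all_plus L})" for v
      using that stab_level_cases by fastforce
  qed
  have "\<sigma> \<in> metastable_states J h L \<longleftrightarrow> \<sigma> = all_minus L" for \<sigma>
    unfolding metastable_states_def G using stab_level_cases [of \<sigma>] minus stab_level_all_minus(1) by auto
  then show ?thesis using G by blast
qed

end

theorem theorem2p5: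
  fixes J h :: real and L :: nat
  assumes "L \<ge> 1"
    and "0 < h" and "h < 1"
    and "J \<ge> 2 * h"
    and "J / (2 * h) - 1/2 \<notin> \<int>"
    and "real (card (Lam L)) \<ge> (4 * J / h)^2"
  shows "metastable_states J h L = {all_minus L} \<and> Gamma_m J h L = ereal (Gamma_Hex J h)"
proof -
  interpret hexagonal_ising J h L using assms by unfold_locales
  show ?thesis by (rule metastable)
qed

end
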